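(* Let $\chi$ be a probability distribution on $\mathbb{N}_0$ with $0<\chi(0)<1$ and probability generating function $G$, and let $k\in\mathbb{N}$. Consider the $k$-jump misère game on the Galton-Watson tree $\mathcal{T}_\chi$ with offspring distribution $\chi$, started at the root. Define $J_k:[0,c_{k-1}]\to[0,1]$ by $$J_k(x)=G\big(\chi(0)+\gamma_k(F_0(x),F_1(x),\ldots,F_k(x))\big)-\chi(0).$$ Then the probability $m\ell_k$ that the first player loses is the minimum positive fixed point of $J_k$. Moreover, the probability that the first player wins is $mw_k=1-F_k(m\ell_k)+\chi(0)$.
   Context: $\mathbb{N}=\{1,2,\dots\}$, $\mathbb{N}_0=\mathbb{N}\cup\{0\}$. $G(x)=\sum_{m\ge 0}\chi(m)x^m$ on $[0,1]$. Game. $\mathcal{T}_\chi$ is the rooted Galton-Watson tree in which every vertex independently has a number of children distributed as $\chi$. For a vertex $u$, $\Gamma_i(u)$ is the set of descendants $v\neq u$ of $u$ at graph distance at most $i$ from $u$. In the $k$-jump misère game a token starts at a vertex; two players P1, P2 alternate (P1 first), and a move relocates the token from its current vertex $u$ to any vertex of $\Gamma_k(u)$. A player unable to move wins. The tree is fully known to both players and both play optimally; a game that goes on forever is a draw. $m\ell_k$ and $mw_k$ are the probabilities (over the random tree) that P1 loses, respectively wins, the $k$-jump misère game started at the root of $\mathcal{T}_\chi$. Functions $F_i$ and numbers $c_i$. $F_0(x)=1$ on $[0,1]$, $c_0=1$, and recursively for $i\in\mathbb{N}$, $F_i:[0,c_{i-1}]\to[0,1]$, $F_i(x)=G(F_{i-1}(x)-x)$,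 where $c_i$ is the unique fixed point of $F_i$ (it is known that $c_i$ exists, is unique, and $c_i<c_{i-1}$). Functions $\gamma_i$. $\gamma_1(x,y)=x-y$ on $\mathbb{R}^2$, and for $i\ge2$, $$\gamma_i(x_0,x_1,\ldots,x_i)=G\big(\chi(0)+\gamma_{i-1}(x_0,x_2,\ldots,x_i)\big)-G\big(\chi(0)+\gamma_{i-1}(x_1,x_2,\ldots,x_i)\big),$$ defined on the set of all $(x_0,\ldots,x_i)$ for which $\chi(0)+\gamma_{i-1}(x_0,x_2,\ldots,x_i)$ and $\chi(0)+\gamma_{i-1}(x_1,x_2,\ldots,x_i)$ are defined and lie in $[0,1]$. *)

theory Defs
  imports "HOL-Probability.Probability"
begin

section \<open>Two-player misere games\<close>

text \<open>
  A game is given by \<^term>\<open>mv\<close>, where \<^term>\<open>mv u\<close> is the set of positions to which the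
  token may be moved from \<open>u\<close>.  A strategy maps the non-empty chronological list of the
  positions visited so far to the next position; its values are constrained only where a move
  exists.
\<close>

definition is_strategy :: "('v \<Rightarrow> 'v set) \<Rightarrow> ('v list \<Rightarrow> 'v) \<Rightarrow> bool" where
  "is_strategy mv \<sigma> \<longleftrightarrow> (\<forall>h. h \<noteq> [] \<and> mv (last h) \<noteq> {} \<longrightarrow> \<sigma> h \<in> mv (last h))"

primrec history :: "('v list \<Rightarrow> 'v) \<Rightarrow> ('v list \<Rightarrow> 'v) \<Rightarrow> 'v \<Rightarrow> nat \<Rightarrow> 'v list" where
  "history \<sigma>1 \<sigma>2 v 0 = [v]"
| "history \<sigma>1 \<sigma>2 v (Suc n) =
     history \<sigma>1 \<sigma>2 v n @ [(if even n then \<sigma>1 else \<sigma>2) (history \<sigma>1 \<sigma>2 v n)]"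

text \<open>
  The play ends after \<open>n\<close> moves when the \<open>n\<close>-th position is the first one without a move;
  later entries of \<^const>\<open>history\<close> are meaningless.  The player then unable to move is P1
  if \<open>n\<close> is even and P2 if \<open>n\<close> is odd.
\<close>

definition ends_after ::
  "('v \<Rightarrow> 'v set) \<Rightarrow> ('v list \<Rightarrow> 'v) \<Rightarrow> ('v list \<Rightarrow> 'v) \<Rightarrow> 'v \<Rightarrow> nat \<Rightarrow> bool" where
  "ends_after mv \<sigma>1 \<sigma>2 v n \<longleftrightarrow>
     mv (last (history \<sigma>1 \<sigma>2 v n)) = {} \<and>
     (\<forall>m<n. mv (last (history \<sigma>1 \<sigma>2 v m)) \<noteq> {})"

text \<open>
  Under optimal play P1 wins (loses) iff P1 (P2) has a strategy that wins against every strategy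
  of the opponent; infinite plays are won by neither player.
\<close>

definition P1_wins :: "('v \<Rightarrow> 'v set) \<Rightarrow> 'v \<Rightarrow> bool" where
  "P1_wins mv v \<longleftrightarrow>
     (\<exists>\<sigma>1. is_strategy mv \<sigma>1 \<and>
        (\<forall>\<sigma>2. is_strategy mv \<sigma>2 \<longrightarrow> (\<exists>n. even n \<and> ends_after mv \<sigma>1 \<sigma>2 v n)))"

definition P1_loses :: "('v \<Rightarrow> 'v set) \<Rightarrow> 'v \<Rightarrow> bool" where
  "P1_loses mv v \<longleftrightarrow>
     (\<exists>\<sigma>2. is_strategy mv \<sigma>2 \<and>
        (\<forall>\<sigma>1. is_strategy mv \<sigma>1 \<longrightarrow> (\<exists>n. odd n \<and> ends_after mv \<sigma>1 \<sigma>2 v n)))"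


section \<open>The \<open>k\<close>-jump game on a Galton-Watson tree\<close>

text \<open>
  Ulam-Harris encoding: the root is \<open>[]\<close> and the children of \<open>u\<close> are \<open>u @ [j]\<close> for
  \<open>j < N u\<close>.  The offspring numbers \<open>N u\<close> are i.i.d. over all words \<open>u\<close>; those of words
  outside the tree play no role.
\<close>

type_synonym vertex = "nat list"

definition offspring_space :: "nat pmf \<Rightarrow> (vertex \<Rightarrow> nat) measure" where
  "offspring_space chi = PiM UNIV (\<lambda>_. measure_pmf chi)"

definition GW_tree :: "(vertex \<Rightarrow> nat) \<Rightarrow> vertex set" where
  "GW_tree N = {u. \<forall>i<length u. u ! i < N (take i u)}"

text \<open>
  A descendant \<open>u @ w\<close> of \<open>u\<close> is at graph distance \<^term>\<open>length w\<close> from \<open>u\<close>.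
\<close>

definition descendants_upto :: "vertex set \<Rightarrow> nat \<Rightarrow> vertex \<Rightarrow> vertex set" where
  "descendants_upto T i u = {u @ w | w. u @ w \<in> T \<and> w \<noteq> [] \<and> length w \<le> i}"

definition ml :: "nat pmf \<Rightarrow> nat \<Rightarrow> real" where
  "ml chi k = measure (offspring_space chi)
     {N \<in> space (offspring_space chi). P1_loses (descendants_upto (GW_tree N) k) []}"

definition mw :: "nat pmf \<Rightarrow> nat \<Rightarrow> real" where
  "mw chi k = measure (offspring_space chi)
     {N \<in> space (offspring_space chi). P1_wins (descendants_upto (GW_tree N) k) []}"


section \<open>The functions \<open>F\<^sub>i\<close>, \<open>\<gamma>\<^sub>i\<close>, \<open>J\<^sub>k\<close> and the numbers \<open>c\<^sub>i\<close>\<close>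

text \<open>
  All functions are total here; their values matter only on the domains on which they are
  defined in the mathematical text (lemmas \<open>c_unique_fixed_point\<close> and \<open>J_well_defined\<close>
  below).
\<close>

definition G :: "nat pmf \<Rightarrow> real \<Rightarrow> real" where
  "G chi x = (\<Sum>m. pmf chi m * x ^ m)"

primrec F :: "nat pmf \<Rightarrow> nat \<Rightarrow> real \<Rightarrow> real" where
  "F chi 0 x = 1"
| "F chi (Suc i) x = G chi (F chi i x - x)"

primrec c :: "nat pmf \<Rightarrow> nat \<Rightarrow> real" where
  "c chi 0 = 1"
| "c chi (Suc i) = (THE x. x \<in> {0..c chi i} \<and> F chi (Suc i) x = x)"

text \<open>
  \<open>\<gamma>\<^sub>i(x\<^sub>0, \<dots>, x\<^sub>i)\<close> is \<open>\<gamma> chi [x\<^sub>0, \<dots>, x\<^sub>i]\<close>: the index is one less than the length of the list.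
  There is no \<open>\<gamma>\<^sub>i\<close> for shorter lists, where the value is arbitrary.  \<open>\<gamma>_defined\<close> is the
  domain of definition.
\<close>

fun \<gamma> :: "nat pmf \<Rightarrow> real list \<Rightarrow> real" where
  "\<gamma> chi [x0, x1] = x0 - x1"
| "\<gamma> chi (x0 # x1 # x2 # xs) =
     G chi (pmf chi 0 + \<gamma> chi (x0 # x2 # xs)) - G chi (pmf chi 0 + \<gamma> chi (x1 # x2 # xs))"
| "\<gamma> chi _ = 0"

fun \<gamma>_defined :: "nat pmf \<Rightarrow> real list \<Rightarrow> bool" where
  "\<gamma>_defined chi [x0, x1] \<longleftrightarrow> True"
| "\<gamma>_defined chi (x0 # x1 # x2 # xs) \<longleftrightarrow>
     \<gamma>_defined chi (x0 # x2 # xs) \<and> pmf chi 0 + \<gamma> chi (x0 # x2 # xs) \<in> {0..1} \<and>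
     \<gamma>_defined chi (x1 # x2 # xs) \<and> pmf chi 0 + \<gamma> chi (x1 # x2 # xs) \<in> {0..1}"
| "\<gamma>_defined chi _ \<longleftrightarrow> False"

definition J :: "nat pmf \<Rightarrow> nat \<Rightarrow> real \<Rightarrow> real" where
  "J chi k x = G chi (pmf chi 0 + \<gamma> chi (map (\<lambda>i. F chi i x) [0..<Suc k])) - pmf chi 0"


section \<open>Well-definedness\<close>

declare F.simps(2) [simp del] c.simps(2) [simp del]

lemma pmf_nat_sums_1: "pmf chi sums (1 :: real)" for chi :: "nat pmf"
  using sums_integral_count_space_nat[of "pmf chi"] integrable_pmf[of UNIV chi] integral_pmf[of UNIV chi]
  by simp

lemma G_summable: "0 \<le> x \<Longrightarrow> x \<le> 1 \<Longrightarrow> summable (\<lambda>m. pmf chi m * x ^ m)" for x :: real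
  by (rule summable_comparison_test'[of "pmf chi" 0])
    (use pmf_nat_sums_1 sums_summable in \<open>auto simp: mult_left_le power_le_one\<close>)

lemma G_0: "G chi 0 = pmf chi 0"
  unfolding G_def using powser_zero[of "pmf chi"] by simp

lemma G_1: "G chi 1 = 1"
  unfolding G_def using pmf_nat_sums_1[of chi] by (simp add: sums_iff)

lemma G_mono:
  assumes "0 \<le> x" "x \<le> y" "y \<le> 1"
  shows "G chi x \<le> G chi y"
  unfolding G_def using assms
  by (intro suminf_le G_summable) (auto intro!: mult_left_mono power_mono)

lemma G_range:
  assumes "0 \<le> x" "x \<le> 1"
  shows "pmf chi 0 \<le> G chi x" "G chi x \<le> 1"
  using G_mono[of 0 x chi] G_mono[of x 1 chi] assms by (auto simp: G_0 G_1)

lemma G_strict_mono: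
  assumes "pmf chi 0 < 1" "0 \<le> x" "x < y" "y \<le> 1"
  shows "G chi x < G chi y"
proof -
  have "\<exists>m\<noteq>0. pmf chi m > 0"
  proof (rule ccontr)
    assume "\<not> ?thesis"
    then have "pmf chi m = 0" if "m \<noteq> 0" for m
      using that pmf_nonneg[of chi m] by (metis order_le_less)
    then have "pmf chi sums pmf chi 0"
      using sums_finite[of "{0}" "pmf chi"] by simp
    then show False
      using sums_unique2[OF _ pmf_nat_sums_1[of chi]] assms(1) by fastforce
  qed
  then obtain m where m: "m \<noteq> 0" "pmf chi m > 0" by blast
  let ?f = "\<lambda>n. pmf chi n * y ^ n - pmf chi n * x ^ n"
  have sx: "summable (\<lambda>n. pmf chi n * x ^ n)" and sy: "summable (\<lambda>n. pmf chi n * y ^ n)"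
    using assms by (auto intro!: G_summable)
  have "0 < suminf ?f"
  proof (rule suminf_pos2[of _ m])
    show "summable ?f" using sx sy by (rule summable_diff[rotated])
    show "0 \<le> ?f n" for n
      using assms by (auto intro!: mult_left_mono power_mono)
    show "0 < ?f m"
      using assms m by (auto intro!: mult_strict_left_mono power_strict_mono)
  qed
  then show ?thesis
    unfolding G_def using suminf_diff[OF sy sx] by simp
qed

lemma G_continuous: "continuous_on {0..1} (G chi)"
proof -
  have "uniform_limit {0..1} (\<lambda>n x. \<Sum>i<n. pmf chi i * x ^ i) (\<lambda>x. \<Sum>i. pmf chi i * x ^ i) sequentially"
    by (rule Weierstrass_m_test[where M = "pmf chi"])
      (use pmf_nat_sums_1 sums_summable in \<open>auto simp: mult_left_le power_le_one\<close>)
  then have "continuous_on {0..1} (\<lambda>x. \<Sum>i. pmf chi i * x ^ i)"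
    by (rule uniform_limit_theorem[rotated]) (auto intro!: always_eventually continuous_intros)
  then show ?thesis
    by (simp add: G_def[abs_def])
qed

context
  fixes chi :: "nat pmf"
  assumes chi0: "0 < pmf chi 0" "pmf chi 0 < 1"
begin

lemma F_step:
  assumes c: "pmf chi 0 < c chi i" "c chi i \<le> 1" "F chi i (c chi i) = c chi i"
    and cont: "continuous_on {0..c chi i} (F chi i)"
    and F0: "F chi i 0 = 1"
    and anti: "\<And>x y. 0 \<le> x \<Longrightarrow> x \<le> y \<Longrightarrow> y \<le> c chi i \<Longrightarrow> F chi i y \<le> F chi i x"
  shows "\<exists>!x. x \<in> {0..c chi i} \<and> F chi (Suc i) x = x"
    and "pmf chi 0 < c chi (Suc i)" "c chi (Suc i) < c chi i"
    and "F chi (Suc i) (c chi (Suc i)) = c chi (Suc i)"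
    and "continuous_on {0..c chi i} (F chi (Suc i))"
    and "F chi (Suc i) 0 = 1"
    and "\<And>x y. 0 \<le> x \<Longrightarrow> x \<le> y \<Longrightarrow> y \<le> c chi i \<Longrightarrow> F chi (Suc i) y \<le> F chi (Suc i) x"
    and "\<And>x. x \<in> {0..c chi i} \<Longrightarrow> F chi i x - x \<in> {0..1}"
proof -
  let ?c = "c chi i"
  have range: "F chi i x - x \<in> {0..1}" if "x \<in> {0..?c}" for x
    using anti[of x ?c] anti[of 0 x] that c F0 by auto
  show "\<And>x. x \<in> {0..?c} \<Longrightarrow> F chi i x - x \<in> {0..1}" by (rule range)
  have cont': "continuous_on {0..?c} (F chi (Suc i))"
    unfolding F.simps(2) using range
    by (intro continuous_on_compose2[OF G_continuous] continuous_intros cont) auto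
  show "continuous_on {0..?c} (F chi (Suc i))" by (rule cont')
  show F0': "F chi (Suc i) 0 = 1" by (simp add: F0 G_1 F.simps(2))
  show anti': "F chi (Suc i) y \<le> F chi (Suc i) x" if "0 \<le> x" "x \<le> y" "y \<le> ?c" for x y
    using that anti[of x y] range[of x] range[of y] by (auto simp: F.simps(2) intro!: G_mono)
  have Fc: "F chi (Suc i) ?c = pmf chi 0" by (simp add: c G_0 F.simps(2))
  have "\<exists>x\<ge>0. x \<le> ?c \<and> F chi (Suc i) x - x = 0"
    using Fc F0' c chi0 by (intro IVT2' continuous_intros cont') auto
  then obtain z where z: "0 \<le> z" "z \<le> ?c" "F chi (Suc i) z = z" by auto
  have uniq: "x = z" if "x \<in> {0..?c} \<and> F chi (Suc i) x = x" for x
    using that z anti'[of x z] anti'[of z x] by (cases "x \<le> z") auto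
  show ex1: "\<exists>!x. x \<in> {0..?c} \<and> F chi (Suc i) x = x"
  proof (rule ex1I[of _ z])
    show "z \<in> {0..?c} \<and> F chi (Suc i) z = z" using z by simp
  qed (rule uniq)
  have cz: "c chi (Suc i) = z"
    unfolding c.simps using z by (intro the1_equality[OF ex1]) simp
  have lt: "z < ?c"
    using z(2,3) Fc c(1) by (metis less_irrefl order_le_less)
  then show "c chi (Suc i) < ?c" unfolding cz .
  show "F chi (Suc i) (c chi (Suc i)) = c chi (Suc i)" unfolding cz by (rule z(3))
  have "0 < F chi i z - z" using anti[of z ?c] z lt c by simp
  then have "G chi 0 < G chi (F chi i z - z)"
    using range[of z] z chi0 by (intro G_strict_mono) auto
  then show "pmf chi 0 < c chi (Suc i)" unfolding cz using z(3) by (simp add: G_0 F.simps(2))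
qed

lemma F_c_properties:
  "pmf chi 0 < c chi i \<and> c chi i \<le> 1 \<and> F chi i (c chi i) = c chi i \<and> continuous_on {0..c chi i} (F chi i) \<and>
   F chi i 0 = 1 \<and> (\<forall>x y. 0 \<le> x \<longrightarrow> x \<le> y \<longrightarrow> y \<le> c chi i \<longrightarrow> F chi i y \<le> F chi i x)"
proof (induction i)
  case 0
  show ?case using chi0 by simp
next
  case (Suc i)
  then have IH: "pmf chi 0 < c chi i" "c chi i \<le> 1" "F chi i (c chi i) = c chi i"
      "continuous_on {0..c chi i} (F chi i)" "F chi i 0 = 1"
      "\<And>x y. 0 \<le> x \<Longrightarrow> x \<le> y \<Longrightarrow> y \<le> c chi i \<Longrightarrow> F chi i y \<le> F chi i x"
    by blast+
  note step = F_step[OF IH]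
  have "c chi (Suc i) \<le> c chi i" using step(3) by simp
  then have "continuous_on {0..c chi (Suc i)} (F chi (Suc i))"
    by (intro continuous_on_subset[OF step(5)]) auto
  moreover have "\<forall>x y. 0 \<le> x \<longrightarrow> x \<le> y \<longrightarrow> y \<le> c chi (Suc i) \<longrightarrow> F chi (Suc i) y \<le> F chi (Suc i) x"
    using step(7) \<open>c chi (Suc i) \<le> c chi i\<close> by (meson order_trans)
  moreover have "c chi (Suc i) \<le> 1" using \<open>c chi (Suc i) \<le> c chi i\<close> IH(2) by (rule order_trans)
  ultimately show ?case
    using step(2,4,6) by blast
qed

lemma F_step':
  shows "\<exists>!x. x \<in> {0..c chi i} \<and> F chi (Suc i) x = x"
    and "pmf chi 0 < c chi (Suc i)" "c chi (Suc i) < c chi i"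
    and "F chi (Suc i) (c chi (Suc i)) = c chi (Suc i)"
    and "x \<in> {0..c chi i} \<Longrightarrow> F chi i x - x \<in> {0..1}"
proof -
  have *: "pmf chi 0 < c chi i" "c chi i \<le> 1" "F chi i (c chi i) = c chi i"
      "continuous_on {0..c chi i} (F chi i)" "F chi i 0 = 1"
      "\<And>x y. 0 \<le> x \<Longrightarrow> x \<le> y \<Longrightarrow> y \<le> c chi i \<Longrightarrow> F chi i y \<le> F chi i x"
    using F_c_properties[of i] by blast+
  show "\<exists>!x. x \<in> {0..c chi i} \<and> F chi (Suc i) x = x" by (rule F_step(1)[OF *])
  show "pmf chi 0 < c chi (Suc i)" by (rule F_step(2)[OF *])
  show "c chi (Suc i) < c chi i" by (rule F_step(3)[OF *])
  show "F chi (Suc i) (c chi (Suc i)) = c chi (Suc i)" by (rule F_step(4)[OF *])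
  show "x \<in> {0..c chi i} \<Longrightarrow> F chi i x - x \<in> {0..1}" by (rule F_step(8)[OF *])
qed

theorem c_unique_fixed_point:
  shows "\<exists>!x. x \<in> {0..c chi i} \<and> F chi (Suc i) x = x"
    and "c chi (Suc i) \<in> {0..c chi i} \<and> F chi (Suc i) (c chi (Suc i)) = c chi (Suc i)"
    and "c chi (Suc i) < c chi i"
    and "x \<in> {0..c chi i} \<Longrightarrow> F chi i x - x \<in> {0..1}"
    and "x \<in> {0..c chi i} \<Longrightarrow> F chi (Suc i) x \<in> {0..1}"
proof -
  show "\<exists>!x. x \<in> {0..c chi i} \<and> F chi (Suc i) x = x" by (rule F_step')
  show "c chi (Suc i) \<in> {0..c chi i} \<and> F chi (Suc i) (c chi (Suc i)) = c chi (Suc i)"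
    using F_step'(2-4)[of i] chi0 by auto
  show "c chi (Suc i) < c chi i" by (rule F_step')
  show r: "F chi i x - x \<in> {0..1}" if "x \<in> {0..c chi i}" using F_step'(5) that .
  show "F chi (Suc i) x \<in> {0..1}" if "x \<in> {0..c chi i}"
    using G_range[of "F chi i x - x" chi] r[OF that] chi0 by (auto simp: F.simps(2))
qed

lemma c_antimono: "i \<le> j \<Longrightarrow> c chi j \<le> c chi i"
  by (rule lift_Suc_antimono_le[of "c chi"]) (simp_all add: less_imp_le[OF F_step'(3)])

lemma F_decreasing_index:
  "x \<in> {0..c chi i} \<Longrightarrow> F chi (Suc i) x \<le> F chi i x"
proof (induction i)
  case 0
  then show ?case using c_unique_fixed_point(5)[of x 0] by simp
next
  case (Suc i)
  have x: "x \<in> {0..c chi i}"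
    using Suc.prems F_step'(3)[of i] by auto
  show ?case
    using Suc.IH[OF x] c_unique_fixed_point(4)[OF x] c_unique_fixed_point(4)[OF Suc.prems]
    unfolding F.simps(2)[of chi "Suc i"] F.simps(2)[of chi i x] by (intro G_mono) auto
qed

lemma F_ge: "i \<le> k \<Longrightarrow> x \<in> {0..c chi (k - 1)} \<Longrightarrow> F chi i x \<in> {pmf chi 0..1}"
proof (cases i)
  case 0
  then show ?thesis using chi0 by simp
next
  case (Suc j)
  assume "i \<le> k" "x \<in> {0..c chi (k - 1)}"
  then have "x \<in> {0..c chi j}" using c_antimono[of j "k - 1"] Suc by fastforce
  from c_unique_fixed_point(4)[OF this] show ?thesis
    using G_range[of "F chi j x - x" chi] Suc by (auto simp: F.simps(2))
qed

lemma F_sorted: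
  assumes "x \<in> {0..c chi (k - 1)}"
  shows "sorted_wrt (\<ge>) (map (\<lambda>i. F chi i x) [0..<Suc k])"
proof -
  have *: "i + d \<le> k \<longrightarrow> F chi (i + d) x \<le> F chi i x" for i d
  proof (induction d)
    case (Suc d)
    show ?case
    proof
      assume le: "i + Suc d \<le> k"
      then have "c chi (k - 1) \<le> c chi (i + d)" by (intro c_antimono) linarith
      then have "x \<in> {0..c chi (i + d)}" using assms by simp
      from F_decreasing_index[OF this] show "F chi (i + Suc d) x \<le> F chi i x"
        using Suc.IH le by simp
    qed
  qed simp
  have "F chi j x \<le> F chi i x" if "i < j" "j < Suc k" for i j
    using *[of i "j - i"] that by simp
  then show ?thesis
    unfolding sorted_wrt_iff_nth_less by (simp del: upt_Suc)
qed

lemma \<gamma>_properties: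
  assumes "sorted_wrt (\<ge>) (x0 # x1 # xs)" "set (x0 # x1 # xs) \<subseteq> {pmf chi 0..1}"
  shows "\<gamma>_defined chi (x0 # x1 # xs) \<and> pmf chi 0 + \<gamma> chi (x0 # x1 # xs) \<in> {pmf chi 0..1} \<and>
    (\<forall>y. x0 \<le> y \<and> y \<le> 1 \<longrightarrow> \<gamma> chi (x0 # x1 # xs) \<le> \<gamma> chi (y # x1 # xs))"
  using assms
proof (induction xs arbitrary: x0 x1)
  case Nil
  then show ?case by auto
next
  case (Cons x2 xs)
  have IH: "\<gamma>_defined chi (z # x2 # xs) \<and> pmf chi 0 + \<gamma> chi (z # x2 # xs) \<in> {pmf chi 0..1} \<and>
    (\<forall>y. z \<le> y \<and> y \<le> 1 \<longrightarrow> \<gamma> chi (z # x2 # xs) \<le> \<gamma> chi (y # x2 # xs))"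
    if "x1 \<le> z" "z \<le> 1" for z
    using that Cons.prems by (intro Cons.IH) auto
  have x: "x1 \<le> x0" "x0 \<le> 1" "x1 \<le> 1" using Cons.prems by auto
  note 0 = IH[of x0] and 1 = IH[of x1]
  have mono: "G chi (pmf chi 0 + \<gamma> chi (z # x2 # xs)) \<le> G chi (pmf chi 0 + \<gamma> chi (y # x2 # xs))"
    if "x1 \<le> z" "z \<le> y" "y \<le> 1" for y z
    using IH[of z] IH[of y] that chi0 by (intro G_mono) auto
  have r: "G chi (pmf chi 0 + \<gamma> chi (z # x2 # xs)) \<in> {pmf chi 0..1}" if "x1 \<le> z" "z \<le> 1" for z
    using IH[of z] that G_range[of "pmf chi 0 + \<gamma> chi (z # x2 # xs)" chi] chi0 by auto
  show ?case
  proof (intro conjI allI impI)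
    show "\<gamma>_defined chi (x0 # x1 # x2 # xs)"
      using 0 1 x chi0 by (simp del: \<gamma>.simps)
    show "pmf chi 0 + \<gamma> chi (x0 # x1 # x2 # xs) \<in> {pmf chi 0..1}"
      using mono[of x1 x0] r[of x0] r[of x1] x by simp
    show "\<gamma> chi (x0 # x1 # x2 # xs) \<le> \<gamma> chi (y # x1 # x2 # xs)" if "x0 \<le> y \<and> y \<le> 1" for y
      using mono[of x0 y] that x by simp
  qed
qed

theorem J_well_defined:
  assumes "1 \<le> k" "x \<in> {0..c chi (k - 1)}"
  defines "Fs \<equiv> map (\<lambda>i. F chi i x) [0..<Suc k]"
  shows "\<gamma>_defined chi Fs" "pmf chi 0 + \<gamma> chi Fs \<in> {0..1}" "J chi k x \<in> {0..1}"
proof -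
  have Fs: "Fs = F chi 0 x # F chi 1 x # map (\<lambda>i. F chi i x) [2..<Suc k]"
    using assms(1) unfolding Fs_def by (simp add: upt_conv_Cons numeral_2_eq_2 del: upt_Suc F.simps)
  have "sorted_wrt (\<ge>) Fs" "set Fs \<subseteq> {pmf chi 0..1}"
    unfolding Fs_def using F_sorted[OF assms(2)] F_ge[OF _ assms(2)] by auto
  then have *: "\<gamma>_defined chi Fs" "pmf chi 0 + \<gamma> chi Fs \<in> {pmf chi 0..1}"
    using \<gamma>_properties unfolding Fs by blast+
  show "\<gamma>_defined chi Fs" by (rule *)
  show r: "pmf chi 0 + \<gamma> chi Fs \<in> {0..1}" using *(2) chi0 by auto
  show "J chi k x \<in> {0..1}"
    unfolding J_def Fs_def[symmetric] using G_range[of "pmf chi 0 + \<gamma> chi Fs" chi] r chi0 by auto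
qed

end

end

theory Submission
  imports Defs
begin

text \<open>
  A finitely branching game is decided by backward induction: P1 loses from a position iff, for
  some \<open>n\<close>, it is lost within \<open>n\<close> rounds, meaning that a move exists and that every
  move leads to a position that is stuck (and so wins under the misere rule) or from which some move
  reaches a position lost within \<open>n - 1\<close> rounds.  On a Galton-Watson tree each of these
  properties of a vertex depends only on the subtree hanging from it, and the subtrees of the children
  of the root are independent copies of the whole tree.  Hence the probability that all children have
  a property is \<open>G\<close> applied to the probability of that property (lemma \<open>prob_all_children\<close>).

  Let \<open>L\<close> be a set of trees (the losing ones) none of which is a single leaf and such that no
  tree in \<open>L\<close> has another one rooted within distance \<open>k\<close> below its root, and let
  \<open>x\<close> be its probability.  A tree has no loser within distance \<open>i + 1\<close> below the root
  iff every child has none within distance \<open>i\<close> and is not itself a loser.  Being a loser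
  already implies having none within distance \<open>i \<le> k\<close>, so the probability of the condition
  on a child is a difference, and by induction \<open>F\<^sub>i(x)\<close> is the probability that there is no
  loser within distance \<open>i\<close>.  A second induction of the same kind, on the depth up to which all
  descendants are winners, identifies the numbers
  \<open>\<chi>(0) + \<gamma>\<^sub>j(F\<^sub>b(x), F\<^bsub>k-j+1\<^esub>(x), \<dots>, F\<^sub>k(x))\<close> as probabilities; for
  \<open>j = k\<close> it gives that one more step of backward induction turns \<open>L\<close> into a set of
  probability \<open>J\<^sub>k(x)\<close>.  These computations are carried out in the locale
  \<open>loss_labelling\<close>.

  The set of trees on which P1 loses is invariant under the step, so its probability is a fixed
  point of \<open>J\<^sub>k\<close>.  It is also the increasing union of the sets lost within \<open>n\<close>
  rounds, whose probabilities are the iterates of \<open>J\<^sub>k\<close> at \<open>0\<close>.  Since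
  \<open>J\<^sub>k\<close> is monotone (lemma \<open>J_mono\<close>), these iterates stay below every fixed point,
  and so does their limit; since \<open>J\<^sub>k(0) > 0\<close>, the limit is positive.  Finally, P1 wins iff
  the root is a leaf or has a loser within distance \<open>k\<close>; these two cases are disjoint and have
  probabilities \<open>\<chi>(0)\<close> and \<open>1 - F\<^sub>k(x)\<close>.
\<close>

section \<open>Backward induction decides finitely branching games\<close>

text \<open>
  The index bounds the number of moves that the losing player still makes.  A position
  without moves is won by the player whose turn it is.
\<close>

primrec loses_within :: "('v \<Rightarrow> 'v set) \<Rightarrow> nat \<Rightarrow> 'v \<Rightarrow> bool" where
  "loses_within mv 0 v \<longleftrightarrow> False"
| "loses_within mv (Suc n) v \<longleftrightarrow>
     mv v \<noteq> {} \<and> (\<forall>w\<in>mv v. mv w = {} \<or> (\<exists>x\<in>mv w. loses_within mv n x))"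

definition wins_within :: "('v \<Rightarrow> 'v set) \<Rightarrow> nat \<Rightarrow> 'v \<Rightarrow> bool" where
  "wins_within mv n v \<longleftrightarrow> mv v = {} \<or> (\<exists>w\<in>mv v. loses_within mv n w)"

lemma loses_within_Suc:
  "loses_within mv (Suc n) v \<longleftrightarrow> mv v \<noteq> {} \<and> (\<forall>w\<in>mv v. wins_within mv n w)"
  by (simp add: wins_within_def)

lemma loses_within_mono: "loses_within mv n v \<Longrightarrow> n \<le> m \<Longrightarrow> loses_within mv m v"
proof (induction n arbitrary: m v)
  case (Suc n)
  then obtain m' where m: "m = Suc m'" "n \<le> m'" by (cases m) auto
  from Suc m show ?case by simp blast
qed simp

lemma wins_within_mono: "wins_within mv n v \<Longrightarrow> n \<le> m \<Longrightarrow> wins_within mv m v"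
  unfolding wins_within_def by (metis loses_within_mono)

text \<open>
  The player who moves at the times \<open>n\<close> with \<^term>\<open>even n = b\<close> uses the positional
  strategy \<open>s\<close>; P1 is the case \<^term>\<open>b = True\<close>.  Treating both players at once lets each
  of the two lemmas on plays below serve for P1 and for P2.
\<close>

definition follows :: "('v \<Rightarrow> 'v set) \<Rightarrow> ('v \<Rightarrow> 'v) \<Rightarrow> bool \<Rightarrow> (nat \<Rightarrow> 'v) \<Rightarrow> bool" where
  "follows mv s b p \<longleftrightarrow>
     (\<forall>n. mv (p n) \<noteq> {} \<longrightarrow> p (Suc n) \<in> mv (p n) \<and> (even n = b \<longrightarrow> p (Suc n) = s (p n)))"

text \<open>
  A move to a position lost within the least possible number of rounds makes that number drop with
  every further round, whatever the opponent does, so the play must stop, and it stops when it is the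
  turn of the player using \<open>s\<close>.
\<close>

lemma winning_play:
  assumes s: "\<And>v. mv v \<noteq> {} \<Longrightarrow> \<exists>n. wins_within mv n v \<Longrightarrow>
      loses_within mv (LEAST n. wins_within mv n v) (s v)"
    and p: "follows mv s b p"
    and "wins_within mv n (p m)" "even m = b"
  shows "\<exists>m'\<ge>m. even m' = b \<and> mv (p m') = {} \<and> (\<forall>i\<in>{m..<m'}. mv (p i) \<noteq> {})"
  using assms(3-)
proof (induction n arbitrary: m rule: less_induct)
  case (less n)
  show ?case
  proof (cases "mv (p m) = {}")
    case True
    then show ?thesis using less.prems by (intro exI[of _ m]) auto
  next
    case ne: False
    define r where "r = (LEAST n. wins_within mv n (p m))"
    have "r \<le> n" unfolding r_def by (rule Least_le) (rule less.prems)
    have "loses_within mv r (s (p m))"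
      unfolding r_def by (rule s) (use ne less.prems in auto)
    moreover have "p (Suc m) = s (p m)" using p ne less.prems by (auto simp: follows_def)
    ultimately have lose: "loses_within mv r (p (Suc m))" by simp
    then obtain r' where r': "r = Suc r'" by (cases r) auto
    have ne': "mv (p (Suc m)) \<noteq> {}" using lose r' by simp
    then have "p (Suc (Suc m)) \<in> mv (p (Suc m))" using p by (auto simp: follows_def)
    then have "wins_within mv r' (p (Suc (Suc m)))"
      using lose unfolding r' loses_within_Suc by blast
    moreover have "r' < n" using r' \<open>r \<le> n\<close> by simp
    moreover have "even (Suc (Suc m)) = b" using less.prems by simp
    ultimately obtain m' where m': "m' \<ge> Suc (Suc m)" "even m' = b" "mv (p m') = {}"
        "\<forall>i\<in>{Suc (Suc m)..<m'}. mv (p i) \<noteq> {}"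
      using less.IH[of r' "Suc (Suc m)"] by blast
    have "mv (p i) \<noteq> {}" if "i \<in> {m..<m'}" for i
    proof -
      have "i = m \<or> i = Suc m \<or> i \<in> {Suc (Suc m)..<m'}" using that by auto
      then show ?thesis using m'(4) ne ne' by blast
    qed
    with m' show ?thesis by (intro exI[of _ m']) auto
  qed
qed

text \<open>
  Finite branching enters here: if every move led to a position won within
  some number of rounds, the maximum of these numbers would bound the loss at \<open>v\<close>.
\<close>

lemma no_loss_move:
  assumes fin: "finite (mv v)" and ne: "mv v \<noteq> {}" and nl: "\<forall>n. \<not> loses_within mv n v"
  shows "\<exists>w\<in>mv v. \<forall>n. \<not> wins_within mv n w"
proof (rule ccontr)
  assume "\<not> ?thesis"
  then obtain r where r: "\<And>w. w \<in> mv v \<Longrightarrow> wins_within mv (r w) w" by metis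
  have "wins_within mv (Max (r ` mv v)) w" if "w \<in> mv v" for w
    by (rule wins_within_mono[OF r[OF that]]) (use that fin in auto)
  then have "loses_within mv (Suc (Max (r ` mv v))) v"
    using ne by (simp add: loses_within_Suc del: loses_within.simps)
  with nl show False by blast
qed

text \<open>
  A player whose position is not lost can keep it so: a safe move reaches a position that the opponent
  does not win, and from there every move leads back to a position that is not lost.  A position that
  is not won has a move, so the play never stops on the opponent's turn.
\<close>

lemma non_losing_play:
  assumes fin: "\<And>v. finite (mv v)"
    and t: "\<And>v. \<exists>w\<in>mv v. \<forall>n. \<not> wins_within mv n w \<Longrightarrow> \<forall>n. \<not> wins_within mv n (t v)"
    and p: "follows mv t b p"
    and start: "if b then \<forall>n. \<not> loses_within mv n (p 0) else \<forall>n. \<not> wins_within mv n (p 0)"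
    and before: "\<forall>i<m. mv (p i) \<noteq> {}"
  shows "if even m = b then \<forall>n. \<not> loses_within mv n (p m) else \<forall>n. \<not> wins_within mv n (p m)"
  using before
proof (induction m)
  case 0
  then show ?case using start by auto
next
  case (Suc m)
  have ne: "mv (p m) \<noteq> {}" and IH: "if even m = b then \<forall>n. \<not> loses_within mv n (p m)
      else \<forall>n. \<not> wins_within mv n (p m)"
    using Suc by auto
  show ?case
  proof (cases "even m = b")
    case True
    then have "p (Suc m) = t (p m)" using p ne by (auto simp: follows_def)
    moreover have "\<forall>n. \<not> wins_within mv n (t (p m))"
      by (rule t, rule no_loss_move) (use IH True fin ne in auto)
    ultimately show ?thesis using True by simp
  next
    case False
    have "p (Suc m) \<in> mv (p m)" using p ne by (auto simp: follows_def)
    moreover have "\<forall>n. \<not> wins_within mv n (p m)" using IH False by simp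
    ultimately have "\<forall>n. \<not> loses_within mv n (p (Suc m))" by (auto simp: wins_within_def)
    with False show ?thesis by simp
  qed
qed

lemma follows_history:
  assumes "is_strategy mv \<sigma>1" "is_strategy mv \<sigma>2"
    and "(if b then \<sigma>1 else \<sigma>2) = (\<lambda>h. s (last h))"
  shows "follows mv s b (\<lambda>n. last (history \<sigma>1 \<sigma>2 v n))"
proof -
  have "history \<sigma>1 \<sigma>2 v n \<noteq> []" for n by (cases n) auto
  then show ?thesis using assms unfolding follows_def is_strategy_def
    by (auto split: if_splits)
qed

text \<open>
  Some legal move is chosen also where none wins, because a strategy has to answer at every position
  that has a move.
\<close>

definition winning_move :: "('v \<Rightarrow> 'v set) \<Rightarrow> 'v \<Rightarrow> 'v" where
  "winning_move mv v = (SOME w. w \<in> mv v \<and>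
     ((\<exists>n. wins_within mv n v) \<longrightarrow> loses_within mv (LEAST n. wins_within mv n v) w))"

lemma winning_move:
  assumes "mv v \<noteq> {}"
  shows "winning_move mv v \<in> mv v"
    and "\<exists>n. wins_within mv n v \<Longrightarrow> loses_within mv (LEAST n. wins_within mv n v) (winning_move mv v)"
proof -
  have "\<exists>w. w \<in> mv v \<and>
     ((\<exists>n. wins_within mv n v) \<longrightarrow> loses_within mv (LEAST n. wins_within mv n v) w)"
  proof (cases "\<exists>n. wins_within mv n v")
    case True
    then have "wins_within mv (LEAST n. wins_within mv n v) v" by (rule LeastI_ex)
    then show ?thesis using assms by (auto simp: wins_within_def)
  qed (use assms in auto)
  from someI_ex[OF this]
  show "winning_move mv v \<in> mv v"
    and "\<exists>n. wins_within mv n v \<Longrightarrow> loses_within mv (LEAST n. wins_within mv n v) (winning_move mv v)"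
    unfolding winning_move_def by blast+
qed

definition safe_move :: "('v \<Rightarrow> 'v set) \<Rightarrow> 'v \<Rightarrow> 'v" where
  "safe_move mv v = (SOME w. w \<in> mv v \<and>
     ((\<exists>w\<in>mv v. \<forall>n. \<not> wins_within mv n w) \<longrightarrow> (\<forall>n. \<not> wins_within mv n w)))"

lemma safe_move:
  shows "mv v \<noteq> {} \<Longrightarrow> safe_move mv v \<in> mv v"
    and "\<exists>w\<in>mv v. \<forall>n. \<not> wins_within mv n w \<Longrightarrow> \<forall>n. \<not> wins_within mv n (safe_move mv v)"
proof -
  have *: "safe_move mv v \<in> mv v \<and>
      ((\<exists>w\<in>mv v. \<forall>n. \<not> wins_within mv n w) \<longrightarrow> (\<forall>n. \<not> wins_within mv n (safe_move mv v)))"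
    if "mv v \<noteq> {}"
    unfolding safe_move_def by (rule someI_ex) (use that in blast)
  show "mv v \<noteq> {} \<Longrightarrow> safe_move mv v \<in> mv v" using * by blast
  show "\<exists>w\<in>mv v. \<forall>n. \<not> wins_within mv n w \<Longrightarrow> \<forall>n. \<not> wins_within mv n (safe_move mv v)"
    using * by blast
qed

lemma positional_is_strategy:
  "(\<And>v. mv v \<noteq> {} \<Longrightarrow> s v \<in> mv v) \<Longrightarrow> is_strategy mv (\<lambda>h. s (last h))"
  by (simp add: is_strategy_def)

theorem P1_wins_iff:
  assumes fin: "\<And>v. finite (mv v)"
  shows "P1_wins mv v \<longleftrightarrow> (\<exists>n. wins_within mv n v)"
proof
  let ?s = "\<lambda>h. winning_move mv (last h)"
  assume win: "\<exists>n. wins_within mv n v"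
  have s: "is_strategy mv ?s" by (intro positional_is_strategy winning_move)
  have "\<exists>n. even n \<and> ends_after mv ?s \<sigma>2 v n" if "is_strategy mv \<sigma>2" for \<sigma>2
  proof -
    have p: "follows mv (winning_move mv) True (\<lambda>n. last (history ?s \<sigma>2 v n))"
      by (rule follows_history[OF s that]) simp
    from win obtain n where "wins_within mv n (last (history ?s \<sigma>2 v 0))" by auto
    from winning_play[OF winning_move(2) p this] obtain m
      where "even m" "mv (last (history ?s \<sigma>2 v m)) = {}"
        "\<forall>i\<in>{0..<m}. mv (last (history ?s \<sigma>2 v i)) \<noteq> {}" by auto
    then show ?thesis unfolding ends_after_def by (intro exI[of _ m]) simp
  qed
  with s show "P1_wins mv v" unfolding P1_wins_def by blast
next
  let ?t = "\<lambda>h. safe_move mv (last h)"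
  have t: "is_strategy mv ?t" by (intro positional_is_strategy safe_move)
  assume "P1_wins mv v"
  then obtain \<sigma>1 n where \<sigma>1: "is_strategy mv \<sigma>1" and n: "even n" "ends_after mv \<sigma>1 ?t v n"
    unfolding P1_wins_def using t by blast
  show "\<exists>n. wins_within mv n v"
  proof (rule ccontr)
    assume "\<nexists>n. wins_within mv n v"
    moreover have "follows mv (safe_move mv) False (\<lambda>n. last (history \<sigma>1 ?t v n))"
      by (rule follows_history[OF \<sigma>1 t]) simp
    ultimately show False
      using non_losing_play[where p = "\<lambda>n. last (history \<sigma>1 ?t v n)" and t = "safe_move mv" and b = False
          and m = n, OF fin safe_move(2)] n by (auto simp: ends_after_def wins_within_def)
  qed
qed

theorem P1_loses_iff:
  assumes fin: "\<And>v. finite (mv v)"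
  shows "P1_loses mv v \<longleftrightarrow> (\<exists>n. loses_within mv n v)"
proof
  let ?s = "\<lambda>h. winning_move mv (last h)"
  assume "\<exists>n. loses_within mv n v"
  \<comment> \<open>A successor index exposes the first move; monotonicity provides it.\<close>
  then obtain n where lose: "loses_within mv (Suc n) v" using loses_within_mono[of mv] le_SucI by blast
  have s: "is_strategy mv ?s" by (intro positional_is_strategy winning_move)
  have "\<exists>n. odd n \<and> ends_after mv \<sigma>1 ?s v n" if "is_strategy mv \<sigma>1" for \<sigma>1
  proof -
    let ?p = "\<lambda>n. last (history \<sigma>1 ?s v n)"
    have p: "follows mv (winning_move mv) False ?p"
      by (rule follows_history[OF that s]) simp
    have ne: "mv (?p 0) \<noteq> {}" using lose by simp
    then have "?p 1 \<in> mv v" using p unfolding follows_def by (metis One_nat_def history.simps(1) last_ConsL)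
    then have "wins_within mv n (?p 1)" using lose unfolding loses_within_Suc by blast
    from winning_play[OF winning_move(2) p this] obtain m where
      m: "m \<ge> 1" "odd m" "mv (?p m) = {}" "\<forall>i\<in>{1..<m}. mv (?p i) \<noteq> {}" by auto
    have "mv (?p i) \<noteq> {}" if "i < m" for i
      using m(4) ne that by (cases "i = 0") auto
    with m show ?thesis unfolding ends_after_def by (intro exI[of _ m]) simp
  qed
  with s show "P1_loses mv v" unfolding P1_loses_def by blast
next
  let ?t = "\<lambda>h. safe_move mv (last h)"
  have t: "is_strategy mv ?t" by (intro positional_is_strategy safe_move)
  assume "P1_loses mv v"
  then obtain \<sigma>2 n where \<sigma>2: "is_strategy mv \<sigma>2" and n: "odd n" "ends_after mv ?t \<sigma>2 v n"
    unfolding P1_loses_def using t by blast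
  show "\<exists>n. loses_within mv n v"
  proof (rule ccontr)
    assume "\<nexists>n. loses_within mv n v"
    moreover have "follows mv (safe_move mv) True (\<lambda>n. last (history ?t \<sigma>2 v n))"
      by (rule follows_history[OF t \<sigma>2]) simp
    ultimately show False
      using non_losing_play[where p = "\<lambda>n. last (history ?t \<sigma>2 v n)" and t = "safe_move mv" and b = True
          and m = n, OF fin safe_move(2)] n by (auto simp: ends_after_def wins_within_def)
  qed
qed

section \<open>Monotonicity of \<open>J\<^sub>k\<close>\<close>

text \<open>
  Convexity of \<open>G\<close>, in the form that compares two increments of the same length without
  mentioning derivatives.
\<close>

lemma G_increment_mono:
  assumes "0 \<le> b" "b \<le> a" "0 \<le> d" "a + d \<le> 1"
  shows "G chi a - G chi b \<le> G chi (a + d) - G chi (b + d)"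
proof -
  have S: "summable (\<lambda>m. pmf chi m * x ^ m)" if "0 \<le> x" "x \<le> a + d" for x
    using that assms by (intro G_summable) auto
  have power: "a ^ m - b ^ m \<le> (a + d) ^ m - (b + d) ^ m" for m
    unfolding power_diff_sumr2[of a m b] power_diff_sumr2[of "a + d" m "b + d"]
    using assms by (auto intro!: mult_mono sum_mono power_mono sum_nonneg)
  have "(\<Sum>m. pmf chi m * a ^ m - pmf chi m * b ^ m) \<le>
      (\<Sum>m. pmf chi m * (a + d) ^ m - pmf chi m * (b + d) ^ m)"
    using assms power
    by (intro suminf_le summable_diff S) (auto simp: right_diff_distrib[symmetric] intro!: mult_left_mono)
  then show ?thesis
    unfolding G_def using assms by (simp add: suminf_diff S)
qed

text \<open>
  The recursion for \<open>\<gamma>\<close> says that the difference only sees the two first arguments and the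
  common tail beyond \<open>x2\<close>; the value \<open>x2\<close> cancels.
\<close>

lemma \<gamma>_diff: "\<gamma> chi (x0 # x2 # xs) - \<gamma> chi (x1 # x2 # xs) = \<gamma> chi (x0 # x1 # xs)"
  by (cases xs) auto

text \<open>
  By definition \<open>\<gamma>(x0, x1, x2, \<dots>)\<close> is an increment \<open>G(A) - G(B)\<close>.  When the
  tail decreases, \<open>A\<close> grows by induction, and so does the length
  \<open>A - B = \<gamma>(x0, x1, x3, \<dots>)\<close>, which by \<open>\<gamma>_diff\<close> is again a value of
  \<open>\<gamma>\<close> with a shorter tail.  Convexity of \<open>G\<close> then makes the increment grow.
\<close>

lemma \<gamma>_antimono_tail:
  assumes chi0: "0 < pmf chi 0" "pmf chi 0 < 1"
    and "sorted_wrt (\<ge>) (x0 # x1 # xs)" "set (x0 # x1 # xs) \<subseteq> {pmf chi 0..1}"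
    and "sorted_wrt (\<ge>) (x0 # y1 # ys)" "set (x0 # y1 # ys) \<subseteq> {pmf chi 0..1}"
    and "list_all2 (\<ge>) (x1 # xs) (y1 # ys)"
  shows "\<gamma> chi (x0 # x1 # xs) \<le> \<gamma> chi (x0 # y1 # ys)"
  using assms(3-)
proof (induction xs arbitrary: x1 y1 ys)
  case Nil
  then show ?case by auto
next
  case (Cons x2 xs)
  then obtain y2 zs where ys: "ys = y2 # zs" by (auto simp: list_all2_Cons1)
  note prems = Cons.prems[unfolded ys]
  define A where "A = pmf chi 0 + \<gamma> chi (x0 # x2 # xs)"
  define B where "B = pmf chi 0 + \<gamma> chi (x1 # x2 # xs)"
  define A' where "A' = pmf chi 0 + \<gamma> chi (x0 # y2 # zs)"
  define B' where "B' = pmf chi 0 + \<gamma> chi (y1 # y2 # zs)"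
  have A: "A \<in> {0..1}" "B \<le> A" and B: "B \<in> {0..1}"
    using \<gamma>_properties[OF chi0, of x1 x2 xs] \<gamma>_properties[OF chi0, of x0 x2 xs] prems chi0
    by (auto simp: A_def B_def)
  have A': "A' \<in> {0..1}" and B': "B' \<in> {0..1}"
    using \<gamma>_properties[OF chi0, of y1 y2 zs] \<gamma>_properties[OF chi0, of x0 y2 zs] prems chi0
    by (auto simp: A'_def B'_def)
  have AA': "A \<le> A'"
    unfolding A_def A'_def using Cons.IH[of x2 y2 zs] prems by auto
  have "A - B = \<gamma> chi (x0 # x1 # xs)" "A' - B' = \<gamma> chi (x0 # y1 # zs)"
    unfolding A_def B_def A'_def B'_def by (simp_all add: \<gamma>_diff)
  moreover have "\<gamma> chi (x0 # x1 # xs) \<le> \<gamma> chi (x0 # y1 # zs)"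
    using Cons.IH[of x1 y1 zs] prems by auto
  ultimately have diff: "A - B \<le> A' - B'" by simp
  have "G chi A - G chi B \<le> G chi (A + (A' - A)) - G chi (B + (A' - A))"
    using A B A' AA' by (intro G_increment_mono) auto
  moreover have "G chi B' \<le> G chi (B + (A' - A))"
    using diff A B A' B' by (intro G_mono) auto
  ultimately have "G chi A - G chi B \<le> G chi A' - G chi B'" by simp
  then show ?case unfolding ys A_def B_def A'_def B'_def by simp
qed

lemma F_antimono:
  assumes chi0: "0 < pmf chi 0" "pmf chi 0 < 1"
    and "i \<le> k" "0 \<le> x" "x \<le> y" "y \<le> c chi (k - 1)"
  shows "F chi i y \<le> F chi i x"
proof (cases i)
  case (Suc j)
  have "c chi (k - 1) \<le> c chi j" using assms Suc by (intro c_antimono chi0) auto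
  then have y: "y \<le> c chi j" using assms by simp
  have "F chi j y \<le> F chi j x"
    using F_c_properties[OF chi0, of j] assms y by blast
  then show ?thesis
    unfolding Suc F.simps(2)
    using c_unique_fixed_point(4)[OF chi0, of x j] c_unique_fixed_point(4)[OF chi0, of y j] assms y
    by (intro G_mono) auto
qed simp

lemma map_F_eq_Cons:
  "1 \<le> k \<Longrightarrow> map (\<lambda>i. F chi i x) [0..<Suc k] = 1 # F chi 1 x # map (\<lambda>i. F chi i x) [2..<Suc k]"
  by (simp add: upt_conv_Cons numeral_2_eq_2 del: upt_Suc)

text \<open>
  The first argument \<open>F\<^sub>0 = 1\<close> of \<open>\<gamma>\<^sub>k\<close> is constant, and all others decrease in
  \<open>x\<close>.
\<close>

lemma J_mono:
  assumes chi0: "0 < pmf chi 0" "pmf chi 0 < 1"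
    and k: "1 \<le> k" and x: "0 \<le> x" "x \<le> y" "y \<le> c chi (k - 1)"
  shows "J chi k x \<le> J chi k y"
proof -
  let ?Fs = "\<lambda>x. map (\<lambda>i. F chi i x) [0..<Suc k]"
  have sorted: "sorted_wrt (\<ge>) (?Fs z)" and set: "set (?Fs z) \<subseteq> {pmf chi 0..1}"
    and J: "pmf chi 0 + \<gamma> chi (?Fs z) \<in> {0..1}" if "z \<in> {0..c chi (k - 1)}" for z
    using F_sorted[OF chi0 that] F_ge[OF chi0 _ that] J_well_defined(2)[OF chi0 k that] by auto
  have "list_all2 (\<ge>) (?Fs x) (?Fs y)"
    using F_antimono[OF chi0 _ x] by (auto simp: list_all2_conv_all_nth simp del: upt_Suc)
  then have "\<gamma> chi (?Fs x) \<le> \<gamma> chi (?Fs y)"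
    using sorted[of x] sorted[of y] set[of x] set[of y] x unfolding map_F_eq_Cons[OF k]
    by (intro \<gamma>_antimono_tail chi0) auto
  then show ?thesis
    unfolding J_def using J[of x] J[of y] x by (auto intro!: G_mono simp del: upt_Suc)
qed

lemma \<gamma>_refl: "\<gamma> chi (x # x # xs) = 0"
  by (cases xs) auto

lemma F_at_0: "F chi i 0 = 1"
  by (induction i) (auto simp: F.simps(2) G_1)

lemma J_0_pos:
  assumes chi0: "0 < pmf chi 0" "pmf chi 0 < 1" and "1 \<le> k"
  shows "0 < J chi k 0"
  using G_strict_mono[OF chi0(2), of 0 "pmf chi 0"] chi0
  unfolding J_def map_F_eq_Cons[OF assms(3)] unfolding F_at_0 \<gamma>_refl by (simp add: G_0)

section \<open>The branching property\<close>

text \<open>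
  The offspring numbers seen from the \<open>j\<close>-th child of the root; for \<open>j < N []\<close> they
  describe the subtree hanging from that child.
\<close>

definition child :: "nat \<Rightarrow> (vertex \<Rightarrow> nat) \<Rightarrow> vertex \<Rightarrow> nat" where
  "child j N = (\<lambda>u. N (j # u))"

lemma space_offspring_space [simp]: "space (offspring_space chi) = UNIV"
  by (simp add: offspring_space_def space_PiM)

lemma prob_space_offspring_space: "prob_space (offspring_space chi)"
  unfolding offspring_space_def by (intro prob_space_PiM measure_pmf.prob_space_axioms)

lemma measurable_PiM_pmf_component:
  assumes "u \<in> I"
  shows "(\<lambda>N. N u) \<in> measurable (PiM I (\<lambda>_. measure_pmf chi)) (count_space UNIV)"
  using measurable_component_singleton[OF assms, of "\<lambda>_. measure_pmf chi"]
  by (simp cong: measurable_cong_sets)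

lemma measurable_offspring_number [measurable]:
  "(\<lambda>N. N u) \<in> measurable (offspring_space chi) (count_space UNIV)"
  unfolding offspring_space_def by (rule measurable_PiM_pmf_component) simp

lemma measurable_child [measurable]:
  "child j \<in> measurable (offspring_space chi) (offspring_space chi)"
  unfolding offspring_space_def child_def
  by (rule measurable_PiM_single') (auto simp: space_PiM intro!: measurable_PiM_pmf_component)

lemma distr_child: "distr (offspring_space chi) (offspring_space chi) (child j) = offspring_space chi"
  using distr_PiM_reindex[of UNIV "\<lambda>_. measure_pmf chi" "Cons j" UNIV]
  by (simp add: offspring_space_def child_def[abs_def] measure_pmf.prob_space_axioms restrict_UNIV)

lemma indep_offspring_numbers:
  "prob_space.indep_vars (offspring_space chi) (\<lambda>_. measure_pmf chi) (\<lambda>u N. N u) UNIV"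
proof -
  interpret prob_space "offspring_space chi" by (rule prob_space_offspring_space)
  have comp: "distr (offspring_space chi) (measure_pmf chi) (\<lambda>N. N u) = measure_pmf chi" for u
    unfolding offspring_space_def by (rule distr_PiM_component) (auto simp: measure_pmf.prob_space_axioms)
  show ?thesis
    by (subst indep_vars_iff_distr_eq_PiM)
       (auto simp: comp restrict_UNIV offspring_space_def[symmetric] distr_id2 cong: measurable_cong_sets)
qed

text \<open>
  The number of children of the root and the subtrees at the children depend on disjoint sets of
  words, hence are independent, and each subtree is distributed as the whole tree.
\<close>

lemma prob_root_and_children:
  assumes [measurable]: "Measurable.pred (offspring_space chi) P"
  shows "measure (offspring_space chi) {N. N [] = m \<and> (\<forall>j<m. P (child j N))} =
    pmf chi m * measure (offspring_space chi) {N. P N} ^ m"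
proof -
  let ?M = "offspring_space chi"
  interpret prob_space ?M by (rule prob_space_offspring_space)
  \<comment> \<open>\<open>None\<close> stands for the root and \<open>Some j\<close> for the words below its \<open>j\<close>-th child.\<close>
  define K :: "nat option \<Rightarrow> vertex set" where "K = case_option {[]} (\<lambda>j. range (Cons j))"
  define Y :: "nat option \<Rightarrow> (vertex \<Rightarrow> nat) \<Rightarrow> bool" where
    "Y = case_option (\<lambda>f. f [] = m) (\<lambda>j f. P (\<lambda>u. f (j # u)))"
  define X :: "nat option \<Rightarrow> (vertex \<Rightarrow> nat) \<Rightarrow> bool" where
    "X = (\<lambda>i N. Y i (restrict N (K i)))"
  have disj: "disjoint_family_on K UNIV"
    by (auto simp: disjoint_family_on_def K_def split: option.splits)
  have meas: "Y i \<in> measurable (PiM (K i) (\<lambda>_. measure_pmf chi)) (count_space UNIV)" for i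
  proof (cases i)
    case None
    have "(\<lambda>f. f []) \<in> measurable (PiM {[]} (\<lambda>_. measure_pmf chi)) (measure_pmf chi)"
      by (rule measurable_component_singleton) simp
    from measurable_compose[OF this, of "\<lambda>n. n = m" "count_space UNIV"] None show ?thesis
      by (simp add: Y_def K_def)
  next
    case (Some j)
    have "(\<lambda>f u. f (j # u)) \<in> measurable (PiM (range (Cons j)) (\<lambda>_. measure_pmf chi)) ?M"
      unfolding offspring_space_def
      by (rule measurable_PiM_single') (auto simp: space_PiM intro!: measurable_PiM_pmf_component)
    from measurable_compose[OF this assms] Some show ?thesis
      by (simp add: Y_def K_def)
  qed
  have "indep_vars (\<lambda>_. count_space UNIV) X UNIV"
    unfolding X_def
    by (rule indep_vars_compose2[OF indep_vars_restrict[OF indep_offspring_numbers _ disj] meas]) simp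
  from indep_varsD[OF this, of "insert None (Some ` {..<m})" "\<lambda>_. {True}"]
  have "measure ?M (\<Inter>i\<in>insert None (Some ` {..<m}). X i -` {True}) =
      measure ?M (X None -` {True}) * (\<Prod>i\<in>Some ` {..<m}. measure ?M (X i -` {True}))"
    by simp
  also have "(\<Prod>i\<in>Some ` {..<m}. measure ?M (X i -` {True})) = measure ?M {N. P N} ^ m"
  proof -
    have "measure ?M (X (Some j) -` {True}) = measure ?M {N. P N}" for j
    proof -
      have "measure ?M {N. P N} = measure (distr ?M ?M (child j)) {N \<in> space ?M. P N}"
        by (simp add: distr_child)
      also have "\<dots> = measure ?M (child j -` {N \<in> space ?M. P N} \<inter> space ?M)"
        by (rule measure_distr) measurable
      also have "child j -` {N \<in> space ?M. P N} \<inter> space ?M = X (Some j) -` {True}"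
        by (auto simp: X_def Y_def K_def child_def)
      finally show ?thesis by simp
    qed
    then show ?thesis by (simp add: prod.reindex)
  qed
  also have "measure ?M (X None -` {True}) = pmf chi m"
  proof -
    have "X None -` {True} = (\<lambda>N. N []) -` {m} \<inter> space ?M"
      by (auto simp: X_def Y_def K_def)
    also have "measure ?M \<dots> = measure (distr ?M (measure_pmf chi) (\<lambda>N. N [])) {m}"
      by (subst measure_distr) (auto simp: offspring_space_def intro!: measurable_PiM_pmf_component)
    also have "distr ?M (measure_pmf chi) (\<lambda>N. N []) = measure_pmf chi"
      unfolding offspring_space_def by (rule distr_PiM_component) (auto simp: measure_pmf.prob_space_axioms)
    finally show ?thesis by (simp add: pmf.rep_eq)
  qed
  also have "(\<Inter>i\<in>insert None (Some ` {..<m}). X i -` {True}) = {N. N [] = m \<and> (\<forall>j<m. P (child j N))}"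
    by (auto simp: X_def Y_def K_def child_def)
  finally show ?thesis .
qed

text \<open>
  The branching property: summing the previous identity over the number \<open>m\<close> of children gives
  the power series of \<open>G\<close>.
\<close>

lemma prob_all_children:
  assumes [measurable]: "Measurable.pred (offspring_space chi) P"
  shows "measure (offspring_space chi) {N. \<forall>j<N []. P (child j N)} =
    G chi (measure (offspring_space chi) {N. P N})"
proof -
  let ?M = "offspring_space chi"
  interpret prob_space ?M by (rule prob_space_offspring_space)
  let ?A = "\<lambda>m. {N. N [] = m \<and> (\<forall>j<m. P (child j N))}"
  have "{N \<in> space ?M. N [] = m \<and> (\<forall>j<m. P (child j N))} \<in> sets ?M" for m
    by measurable
  then have "(\<lambda>m. measure ?M (?A m)) sums measure ?M (\<Union>m. ?A m)"
    by (intro finite_measure_UNION) (auto simp: disjoint_family_on_def)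
  moreover have "(\<Union>m. ?A m) = {N. \<forall>j<N []. P (child j N)}" by auto
  ultimately show ?thesis
    by (simp add: prob_root_and_children G_def sums_iff)
qed

section \<open>One step of backward induction on trees\<close>

text \<open>
  All proper descendants of the root at distance at most \<open>i\<close> carry subtrees with property
  \<open>P\<close>.  The recursion through the children, rather than a quantifier over vertices, is what makes
  the branching property applicable (\<open>all_upto_iff\<close> gives the agreement of the two).
\<close>

primrec all_upto :: "((vertex \<Rightarrow> nat) \<Rightarrow> bool) \<Rightarrow> nat \<Rightarrow> (vertex \<Rightarrow> nat) \<Rightarrow> bool" where
  "all_upto P 0 N \<longleftrightarrow> True"
| "all_upto P (Suc i) N \<longleftrightarrow> (\<forall>j<N []. P (child j N) \<and> all_upto P i (child j N))"

text \<open>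
  If \<open>L\<close> collects trees already known to be lost, these are the trees from which the player to
  move wins, respectively loses, by looking one more move, respectively one more round, ahead.
\<close>

definition win_step :: "nat \<Rightarrow> ((vertex \<Rightarrow> nat) \<Rightarrow> bool) \<Rightarrow> (vertex \<Rightarrow> nat) \<Rightarrow> bool" where
  "win_step k L N \<longleftrightarrow> N [] = 0 \<or> \<not> all_upto (\<lambda>M. \<not> L M) k N"

definition loss_step :: "nat \<Rightarrow> ((vertex \<Rightarrow> nat) \<Rightarrow> bool) \<Rightarrow> (vertex \<Rightarrow> nat) \<Rightarrow> bool" where
  "loss_step k L N \<longleftrightarrow> N [] \<noteq> 0 \<and> all_upto (win_step k L) k N"

lemma all_upto_mono: "(\<And>M. P M \<Longrightarrow> Q M) \<Longrightarrow> all_upto P i N \<Longrightarrow> all_upto Q i N"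
  by (induction i arbitrary: N) auto

lemma all_upto_leaf: "N [] = 0 \<Longrightarrow> all_upto P i N"
  by (cases i) auto

lemma all_upto_antimono_depth: "all_upto P i N \<Longrightarrow> j \<le> i \<Longrightarrow> all_upto P j N"
proof (induction j arbitrary: i N)
  case (Suc j)
  then obtain i' where "i = Suc i'" "j \<le> i'" by (cases i) auto
  with Suc show ?case by auto
qed simp

lemma measurable_all_upto [measurable]:
  assumes [measurable]: "Measurable.pred (offspring_space chi) P"
  shows "Measurable.pred (offspring_space chi) (all_upto P i)"
proof (induction i)
  case 0
  have "all_upto P 0 = (\<lambda>_. True)" by auto
  then show ?case by simp
next
  case (Suc i)
  note [measurable] = Suc
  have "all_upto P (Suc i) = (\<lambda>N. \<forall>j. j < N [] \<longrightarrow> P (child j N) \<and> all_upto P i (child j N))"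
    by auto
  then show ?case by simp
qed

lemma measurable_win_step [measurable]:
  assumes [measurable]: "Measurable.pred (offspring_space chi) L"
  shows "Measurable.pred (offspring_space chi) (win_step k L)"
  unfolding win_step_def[abs_def] by measurable

lemma measurable_loss_step [measurable]:
  assumes [measurable]: "Measurable.pred (offspring_space chi) L"
  shows "Measurable.pred (offspring_space chi) (loss_step k L)"
  unfolding loss_step_def[abs_def] by measurable

section \<open>Probabilities of losing and winning in the next step\<close>

abbreviation pr :: "nat pmf \<Rightarrow> ((vertex \<Rightarrow> nat) \<Rightarrow> bool) \<Rightarrow> real" where
  "pr chi P \<equiv> measure (offspring_space chi) {N. P N}"

lemma pr_and_not:
  assumes [measurable]: "Measurable.pred (offspring_space chi) P" "Measurable.pred (offspring_space chi) Q"
    and "\<And>N. Q N \<Longrightarrow> P N"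
  shows "pr chi (\<lambda>N. P N \<and> \<not> Q N) = pr chi P - pr chi Q"
proof -
  interpret prob_space "offspring_space chi" by (rule prob_space_offspring_space)
  have "{N \<in> space (offspring_space chi). P N} \<in> events" "{N \<in> space (offspring_space chi). Q N} \<in> events"
    by measurable
  then have "prob ({N. P N} - {N. Q N}) = pr chi P - pr chi Q"
    using assms(3) by (intro finite_measure_Diff) auto
  moreover have "{N. P N} - {N. Q N} = {N. P N \<and> \<not> Q N}" by auto
  ultimately show ?thesis by simp
qed

lemma pr_leaf: "pr chi (\<lambda>N. N [] = 0) = pmf chi 0"
  using prob_root_and_children[of "\<lambda>_. True" chi 0] by simp

lemma pr_leaf_or:
  assumes [measurable]: "Measurable.pred (offspring_space chi) P" and "\<And>N. P N \<Longrightarrow> N [] \<noteq> 0"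
  shows "pr chi (\<lambda>N. N [] = 0 \<or> P N) = pmf chi 0 + pr chi P"
proof -
  have "pr chi (\<lambda>N. (N [] = 0 \<or> P N) \<and> \<not> N [] = 0) = pr chi (\<lambda>N. N [] = 0 \<or> P N) - pmf chi 0"
    by (subst pr_and_not) (auto simp: pr_leaf)
  also have "(\<lambda>N. (N [] = 0 \<or> P N) \<and> \<not> N [] = 0) = P" using assms(2) by auto
  finally show ?thesis by simp
qed

text \<open>
  The computation below applies both to the trees lost within \<open>n\<close> rounds and to all trees on
  which P1 loses.  The locale isolates what the computation uses of these sets; the last assumption
  holds for them because every move from a losing position leads to a winning one, which is not losing.
\<close>

locale loss_labelling =
  fixes chi :: "nat pmf" and k :: nat and L :: "(vertex \<Rightarrow> nat) \<Rightarrow> bool"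
  assumes chi0: "0 < pmf chi 0" "pmf chi 0 < 1" and k: "1 \<le> k"
    and L_measurable [measurable]: "Measurable.pred (offspring_space chi) L"
    and L_leaf: "L N \<Longrightarrow> N [] \<noteq> 0"
    and L_free: "L N \<Longrightarrow> all_upto (\<lambda>M. \<not> L M) k N"
begin

abbreviation S where "S \<equiv> all_upto (\<lambda>M. \<not> L M)"
abbreviation W where "W \<equiv> win_step k L"

text \<open>
  The loser event is contained in \<open>S i\<close> for \<open>i \<le> k\<close>, so excluding it costs exactly
  its probability; this is the term \<open>- x\<close> in \<open>F\<^bsub>i+1\<^esub>(x) = G(F\<^sub>i(x) - x)\<close>.
\<close>

lemma pr_S: "i \<le> k \<Longrightarrow> pr chi (S i) = F chi i (pr chi L)"
proof (induction i)
  case 0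
  interpret prob_space "offspring_space chi" by (rule prob_space_offspring_space)
  show ?case using prob_space by simp
next
  case (Suc i)
  have "pr chi (S (Suc i)) = G chi (pr chi (\<lambda>N. S i N \<and> \<not> L N))"
    by (subst prob_all_children[symmetric]) (auto intro!: arg_cong[where f = "measure _"])
  also have "pr chi (\<lambda>N. S i N \<and> \<not> L N) = pr chi (S i) - pr chi L"
    using all_upto_antimono_depth[OF L_free] Suc.prems by (intro pr_and_not) auto
  finally show ?case using Suc by (simp add: F.simps(2))
qed

text \<open>
  With \<open>x\<close> the probability of \<open>L\<close>, the inclusion of \<open>L\<close> in \<open>S i\<close> reads
  \<open>x \<le> F\<^sub>i(x)\<close>, which for the decreasing function \<open>F\<^sub>i\<close> places \<open>x\<close> below its
  fixed point \<open>c\<^sub>i\<close>.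
\<close>

lemma pr_L_le_c: "pr chi L \<in> {0..c chi (k - 1)}"
proof -
  interpret prob_space "offspring_space chi" by (rule prob_space_offspring_space)
  let ?x = "pr chi L"
  have le: "?x \<le> F chi i ?x" if "i \<le> k" for i
  proof -
    have "?x \<le> pr chi (S i)"
    proof (rule finite_measure_mono)
      have "{N \<in> space (offspring_space chi). S i N} \<in> events" by measurable
      then show "{N. S i N} \<in> events" by simp
    qed (use all_upto_antimono_depth[OF L_free] that in auto)
    then show ?thesis using pr_S that by simp
  qed
  have "?x \<le> c chi i" if "i < k" for i
    using that
  proof (induction i)
    case (Suc i)
    show ?case
    proof (rule ccontr)
      assume "\<not> ?x \<le> c chi (Suc i)"
      then have "F chi (Suc i) ?x \<le> F chi (Suc i) (c chi (Suc i))"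
        using Suc c_unique_fixed_point(2)[OF chi0, of i]
        by (intro F_antimono[where k = "Suc i"] chi0) auto
      then show False
        using le[of "Suc i"] Suc.prems c_unique_fixed_point(2)[OF chi0, of i] \<open>\<not> ?x \<le> c chi (Suc i)\<close>
        by auto
    qed
  qed simp
  from this[of "k - 1"] k show ?thesis by simp
qed

text \<open>
  The root and all its descendants down to depth \<open>j\<close> are winning, and there is no loser within
  distance \<open>b + j\<close>.  These are the events whose probabilities are
  \<open>\<chi>(0) + \<gamma>\<^bsub>j+1\<^esub>(F\<^sub>b, F\<^bsub>k-j\<^esub>, \<dots>, F\<^sub>k)\<close>; single leaves belong to all of
  them and contribute the \<open>\<chi>(0)\<close>.
\<close>

definition R :: "nat \<Rightarrow> nat \<Rightarrow> (vertex \<Rightarrow> nat) \<Rightarrow> bool" where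
  "R j b N \<longleftrightarrow> W N \<and> all_upto W j N \<and> S (b + j) N"

lemma R_measurable [measurable]: "Measurable.pred (offspring_space chi) (R j b)"
  unfolding R_def[abs_def] by measurable

lemma W_not_L: "W N \<Longrightarrow> \<not> L N"
  using L_leaf L_free unfolding win_step_def by blast

lemma S_k_iff: "S k N \<longleftrightarrow> (\<forall>j<N []. \<not> L (child j N) \<and> S (k - 1) (child j N))"
  using k by (cases k) auto

text \<open>
  A root that is not a leaf wins iff it has a loser within distance \<open>k\<close>.  When all children are
  winners, none of them is that loser, so it lies within distance \<open>k - 1\<close> of some child.  The
  second condition on the right excludes exactly that all children are free of such losers, since
  \<open>(k - Suc j) + j = k - 1\<close>.
\<close>

lemma R_Suc_iff:
  assumes "Suc j \<le> k" "N [] \<noteq> 0"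
  shows "R (Suc j) b N \<longleftrightarrow>
    (\<forall>i<N []. R j b (child i N)) \<and> \<not> (\<forall>i<N []. R j (k - Suc j) (child i N))"
proof -
  have "k - Suc j + j = k - 1" using assms by simp
  then have "R j (k - Suc j) M \<longleftrightarrow> W M \<and> all_upto W j M \<and> S (k - 1) M" for M
    by (simp add: R_def)
  moreover have "W N \<longleftrightarrow> \<not> S k N" using assms by (simp add: win_step_def)
  ultimately show ?thesis
    using W_not_L by (auto simp: R_def S_k_iff)
qed

text \<open>
  For a root that is not a leaf, \<open>R_Suc_iff\<close> writes the event as a difference of two nested
  events about all children, which is the difference of two values of \<open>G\<close> in the recursion for
  \<open>\<gamma>\<close>.  The bound on \<open>b\<close> makes the events nested.
\<close>

lemma pr_R:
  assumes "j < k" "b \<le> k - j"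
  shows "pr chi (R j b) =
    pmf chi 0 + \<gamma> chi (F chi b (pr chi L) # map (\<lambda>i. F chi i (pr chi L)) [k - j..<Suc k])"
  using assms
proof (induction j arbitrary: b)
  case 0
  have "R 0 b N \<longleftrightarrow> N [] = 0 \<or> (S b N \<and> \<not> S k N)" for N
    by (auto simp: R_def win_step_def all_upto_leaf)
  then have "pr chi (R 0 b) = pmf chi 0 + pr chi (\<lambda>N. S b N \<and> \<not> S k N)"
    by (simp, intro pr_leaf_or) (measurable, metis all_upto_leaf)
  also have "pr chi (\<lambda>N. S b N \<and> \<not> S k N) = pr chi (S b) - pr chi (S k)"
    using 0 by (intro pr_and_not) (auto intro: all_upto_antimono_depth)
  finally show ?case using 0 by (simp add: pr_S)
next
  case (Suc j)
  let ?a = "k - Suc j"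
  let ?all = "\<lambda>b N. \<forall>i<N []. R j b (child i N)"
  have all_measurable [measurable]: "Measurable.pred (offspring_space chi) (?all b)" for b
  proof -
    have "Measurable.pred (offspring_space chi) (\<lambda>N. \<forall>i. i < N [] \<longrightarrow> R j b (child i N))"
      by measurable
    then show ?thesis by simp
  qed
  have "R (Suc j) b N \<longleftrightarrow> N [] = 0 \<or> (?all b N \<and> \<not> ?all ?a N)" for N
  proof (cases "N [] = 0")
    case True
    then show ?thesis by (simp add: R_def win_step_def all_upto_leaf)
  next
    case False
    with R_Suc_iff[of j N b] Suc.prems show ?thesis by simp
  qed
  then have "pr chi (R (Suc j) b) = pmf chi 0 + pr chi (\<lambda>N. ?all b N \<and> \<not> ?all ?a N)"
    by (simp, intro pr_leaf_or) auto
  also have "pr chi (\<lambda>N. ?all b N \<and> \<not> ?all ?a N) = pr chi (?all b) - pr chi (?all ?a)"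
  proof (rule pr_and_not)
    have "b + j \<le> ?a + j" using Suc.prems by simp
    then show "?all ?a N \<Longrightarrow> ?all b N" for N
      unfolding R_def using all_upto_antimono_depth by blast
  qed measurable
  also have "\<dots> = G chi (pr chi (R j b)) - G chi (pr chi (R j ?a))"
    by (simp add: prob_all_children)
  also have "pr chi (R j b) =
      pmf chi 0 + \<gamma> chi (F chi b (pr chi L) # map (\<lambda>i. F chi i (pr chi L)) [k - j..<Suc k])"
    using Suc.prems by (intro Suc.IH) auto
  also have "pr chi (R j ?a) =
      pmf chi 0 + \<gamma> chi (F chi ?a (pr chi L) # map (\<lambda>i. F chi i (pr chi L)) [k - j..<Suc k])"
    using Suc.prems by (intro Suc.IH) auto
  finally show ?case
    using Suc.prems by (simp add: upt_conv_Cons[of "k - Suc j"] upt_conv_Cons[of "k - j"]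
      Suc_diff_Suc del: upt_Suc)
qed

text \<open>
  A tree is lost in the next step iff it is not a leaf and all children satisfy
  \<^term>\<open>R (k - 1) 0\<close>; the condition on losers in \<open>R\<close> then follows from the others, as winners
  are not losers.
\<close>

lemma pr_loss_step: "pr chi (loss_step k L) = J chi k (pr chi L)"
proof -
  have R: "R (k - 1) 0 N \<longleftrightarrow> W N \<and> all_upto W (k - 1) N" for N
    using W_not_L by (auto simp: R_def intro: all_upto_mono[of W])
  let ?all = "\<lambda>N. \<forall>i<N []. R (k - 1) 0 (child i N)"
  have all_measurable [measurable]: "Measurable.pred (offspring_space chi) ?all"
  proof -
    have "Measurable.pred (offspring_space chi) (\<lambda>N. \<forall>i. i < N [] \<longrightarrow> R (k - 1) 0 (child i N))"
      by measurable
    then show ?thesis by simp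
  qed
  have "all_upto W k N \<longleftrightarrow> ?all N" for N
    unfolding R using k by (cases k) auto
  then have "loss_step k L N \<longleftrightarrow> ?all N \<and> \<not> N [] = 0" for N
    by (auto simp: loss_step_def)
  then have "pr chi (loss_step k L) = pr chi (\<lambda>N. ?all N \<and> \<not> N [] = 0)" by simp
  also have "\<dots> = pr chi ?all - pr chi (\<lambda>N. N [] = 0)"
    by (rule pr_and_not) auto
  also have "pr chi ?all = G chi (pr chi (R (k - 1) 0))"
    by (simp add: prob_all_children)
  also have "pr chi (R (k - 1) 0) = pmf chi 0 + \<gamma> chi (map (\<lambda>i. F chi i (pr chi L)) [0..<Suc k])"
    using k by (subst pr_R) (auto simp: upt_conv_Cons[of 0] simp del: upt_Suc)
  finally show ?thesis by (simp add: J_def pr_leaf)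
qed

lemma pr_W: "pr chi W = 1 - F chi k (pr chi L) + pmf chi 0"
proof -
  interpret prob_space "offspring_space chi" by (rule prob_space_offspring_space)
  have "pr chi W = pmf chi 0 + pr chi (\<lambda>N. True \<and> \<not> S k N)"
    by (simp add: win_step_def, intro pr_leaf_or) (measurable, metis all_upto_leaf)
  also have "pr chi (\<lambda>N. True \<and> \<not> S k N) = pr chi (\<lambda>_. True) - pr chi (S k)"
    by (rule pr_and_not) auto
  finally show ?thesis using prob_space by (simp add: pr_S)
qed

end

section \<open>The game on the tree as a property of subtrees\<close>

text \<open>
  The offspring numbers seen from the vertex \<open>u\<close>; iterating \<^const>\<open>child\<close> along \<open>u\<close>
  gives the same function.
\<close>

definition subtree :: "vertex \<Rightarrow> (vertex \<Rightarrow> nat) \<Rightarrow> vertex \<Rightarrow> nat" where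
  "subtree u N = (\<lambda>w. N (u @ w))"

lemma subtree_simps [simp]:
  "subtree [] N = N" "subtree u N [] = N u" "subtree w (subtree u N) = subtree (u @ w) N"
  by (auto simp: subtree_def child_def)

lemma Nil_in_GW_tree [simp]: "[] \<in> GW_tree N"
  by (simp add: GW_tree_def)

lemma Cons_in_GW_tree [simp]: "j # w \<in> GW_tree N \<longleftrightarrow> j < N [] \<and> w \<in> GW_tree (child j N)"
  by (auto simp: GW_tree_def child_def All_less_Suc2)

lemma append_in_GW_tree:
  "u @ w \<in> GW_tree N \<longleftrightarrow> u \<in> GW_tree N \<and> w \<in> GW_tree (subtree u N)"
proof (induction u arbitrary: N)
  case (Cons j u)
  have "subtree u (child j N) = subtree (j # u) N" by (auto simp: subtree_def child_def)
  with Cons show ?case by auto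
qed simp

lemma all_upto_iff:
  "all_upto P i N \<longleftrightarrow> (\<forall>w\<in>GW_tree N. w \<noteq> [] \<and> length w \<le> i \<longrightarrow> P (subtree w N))"
proof (induction i arbitrary: N)
  case (Suc i)
  have sub: "subtree w (child j N) = subtree (j # w) N" for j w
    by (auto simp: subtree_def child_def)
  have "(\<forall>w\<in>GW_tree N. w \<noteq> [] \<and> length w \<le> Suc i \<longrightarrow> P (subtree w N)) \<longleftrightarrow>
      (\<forall>j<N []. \<forall>w\<in>GW_tree (child j N). length w \<le> i \<longrightarrow> P (subtree (j # w) N))"
  proof safe
    fix w assume *: "\<forall>j<N []. \<forall>w\<in>GW_tree (child j N). length w \<le> i \<longrightarrow> P (subtree (j # w) N)"
      and w: "w \<in> GW_tree N" "w \<noteq> []" "length w \<le> Suc i"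
    then obtain j w' where "w = j # w'" by (cases w) auto
    with * w show "P (subtree w N)" by auto
  qed auto
  also have "\<dots> \<longleftrightarrow> (\<forall>j<N []. P (child j N) \<and> all_upto P i (child j N))"
  proof -
    have "(\<forall>w\<in>GW_tree (child j N). length w \<le> i \<longrightarrow> P (subtree (j # w) N)) \<longleftrightarrow>
      P (child j N) \<and> all_upto P i (child j N)" for j
      unfolding Suc sub[symmetric]
      by (metis (no_types, lifting) Nil_in_GW_tree le0 list.size(3) subtree_simps(1))
    then show ?thesis by auto
  qed
  finally show ?case by simp
qed simp

lemma descendants_iff_all_upto:
  assumes "u \<in> GW_tree N"
  shows "(\<forall>v\<in>descendants_upto (GW_tree N) i u. P (subtree v N)) \<longleftrightarrow> all_upto P i (subtree u N)"
  using assms by (auto simp: all_upto_iff descendants_upto_def append_in_GW_tree)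

lemma no_descendants_iff:
  assumes "u \<in> GW_tree N" "1 \<le> k"
  shows "descendants_upto (GW_tree N) k u = {} \<longleftrightarrow> N u = 0"
proof -
  have "all_upto (\<lambda>_. False) k (subtree u N) \<longleftrightarrow> N u = 0"
    using assms(2) by (cases k) auto
  with descendants_iff_all_upto[OF assms(1), of k "\<lambda>_. False"] show ?thesis by auto
qed

lemma descendants_in_GW_tree: "v \<in> descendants_upto (GW_tree N) k u \<Longrightarrow> v \<in> GW_tree N"
  by (auto simp: descendants_upto_def)

lemma finite_GW_tree_level: "finite {w \<in> GW_tree N. length w \<le> i}"
proof (induction i arbitrary: N)
  case (Suc i)
  have "{w \<in> GW_tree N. length w \<le> Suc i} \<subseteq>
      insert [] (\<Union>j<N []. Cons j ` {w \<in> GW_tree (child j N). length w \<le> i})"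
  proof
    fix w assume "w \<in> {w \<in> GW_tree N. length w \<le> Suc i}"
    then show "w \<in> insert [] (\<Union>j<N []. Cons j ` {w \<in> GW_tree (child j N). length w \<le> i})"
      by (cases w) auto
  qed
  then show ?case by (rule finite_subset) (auto intro: Suc)
qed simp

lemma finite_descendants: "finite (descendants_upto (GW_tree N) k u)"
proof (rule finite_subset)
  show "descendants_upto (GW_tree N) k u \<subseteq> (@) u ` {w \<in> GW_tree (subtree u N). length w \<le> k}"
    by (auto simp: descendants_upto_def append_in_GW_tree)
qed (simp add: finite_GW_tree_level)

section \<open>Stages of backward induction and their limit\<close>

primrec loses_upto :: "nat \<Rightarrow> nat \<Rightarrow> (vertex \<Rightarrow> nat) \<Rightarrow> bool" where
  "loses_upto k 0 = (\<lambda>N. False)"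
| "loses_upto k (Suc n) = loss_step k (loses_upto k n)"

definition loses_ever :: "nat \<Rightarrow> (vertex \<Rightarrow> nat) \<Rightarrow> bool" where
  "loses_ever k N \<longleftrightarrow> (\<exists>n. loses_upto k n N)"

lemma wins_within_iff_win_step:
  assumes "1 \<le> k" and "u \<in> GW_tree N"
    and loses: "\<And>v. v \<in> GW_tree N \<Longrightarrow>
      loses_within (descendants_upto (GW_tree N) k) n v \<longleftrightarrow> L (subtree v N)"
  shows "wins_within (descendants_upto (GW_tree N) k) n u \<longleftrightarrow> win_step k L (subtree u N)"
proof -
  have "(\<exists>v\<in>descendants_upto (GW_tree N) k u. loses_within (descendants_upto (GW_tree N) k) n v) \<longleftrightarrow>
      \<not> (\<forall>v\<in>descendants_upto (GW_tree N) k u. \<not> L (subtree v N))"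
    using loses descendants_in_GW_tree by blast
  also have "\<dots> \<longleftrightarrow> \<not> all_upto (\<lambda>M. \<not> L M) k (subtree u N)"
    by (simp only: descendants_iff_all_upto[OF assms(2), of k "\<lambda>M. \<not> L M"])
  finally show ?thesis
    using assms by (simp add: wins_within_def win_step_def no_descendants_iff)
qed

lemma loses_within_iff_loses_upto:
  assumes k: "1 \<le> k" and "u \<in> GW_tree N"
  shows "loses_within (descendants_upto (GW_tree N) k) n u \<longleftrightarrow> loses_upto k n (subtree u N)"
  using assms(2)
proof (induction n arbitrary: u)
  case (Suc n)
  have "(\<forall>v\<in>descendants_upto (GW_tree N) k u. wins_within (descendants_upto (GW_tree N) k) n v) \<longleftrightarrow>
      (\<forall>v\<in>descendants_upto (GW_tree N) k u. win_step k (loses_upto k n) (subtree v N))"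
    using wins_within_iff_win_step[OF k descendants_in_GW_tree Suc.IH] by blast
  also have "\<dots> \<longleftrightarrow> all_upto (win_step k (loses_upto k n)) k (subtree u N)"
    by (rule descendants_iff_all_upto[OF Suc.prems])
  finally show ?case
    using k Suc.prems unfolding loses_within_Suc by (simp add: loss_step_def no_descendants_iff)
qed simp

lemma all_upto_all: "all_upto (\<lambda>M. \<forall>n. P n M) i N \<longleftrightarrow> (\<forall>n. all_upto (P n) i N)"
  by (induction i arbitrary: N) auto

text \<open>
  Only finitely many vertices lie within distance \<open>i\<close>, so a common index can be chosen for an
  increasing sequence of properties.
\<close>

lemma all_upto_ex:
  fixes P :: "nat \<Rightarrow> (vertex \<Rightarrow> nat) \<Rightarrow> bool"
  assumes mono: "\<And>m n M. P m M \<Longrightarrow> m \<le> n \<Longrightarrow> P n M"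
  shows "all_upto (\<lambda>M. \<exists>n. P n M) i N \<longleftrightarrow> (\<exists>n. all_upto (P n) i N)"
proof
  have mono_all: "all_upto (P n) i N" if "all_upto (P m) i N" "m \<le> n" for m n i N
    by (rule all_upto_mono[OF mono that(1)]) (use that in auto)
  show "\<exists>n. all_upto (P n) i N \<Longrightarrow> all_upto (\<lambda>M. \<exists>n. P n M) i N"
    by (auto intro: all_upto_mono)
  show "all_upto (\<lambda>M. \<exists>n. P n M) i N \<Longrightarrow> \<exists>n. all_upto (P n) i N"
  proof (induction i arbitrary: N)
    case (Suc i)
    then have "\<forall>j<N []. \<exists>n. P n (child j N) \<and> all_upto (P n) i (child j N)"
    proof (intro allI impI)
      fix j assume "j < N []"
      then obtain m n where "P m (child j N)" "all_upto (P n) i (child j N)"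
        using Suc by fastforce
      then have "P (max m n) (child j N)" "all_upto (P (max m n)) i (child j N)"
        using mono mono_all max.cobounded1 max.cobounded2 by blast+
      then show "\<exists>n. P n (child j N) \<and> all_upto (P n) i (child j N)" by blast
    qed
    then obtain r where r: "\<And>j. j < N [] \<Longrightarrow> P (r j) (child j N) \<and> all_upto (P (r j)) i (child j N)"
      by metis
    have "P (Max (r ` {..<N []})) (child j N) \<and> all_upto (P (Max (r ` {..<N []}))) i (child j N)"
      if "j < N []" for j
    proof -
      have "r j \<le> Max (r ` {..<N []})" using that by simp
      with r[OF that] show ?thesis using mono mono_all by blast
    qed
    then show ?case by auto
  qed simp
qed

lemma win_step_mono: "(\<And>M. L M \<Longrightarrow> L' M) \<Longrightarrow> win_step k L N \<Longrightarrow> win_step k L' N"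
  unfolding win_step_def using all_upto_mono[of "\<lambda>M. \<not> L' M" "\<lambda>M. \<not> L M"] by blast

lemma loss_step_mono: "(\<And>M. L M \<Longrightarrow> L' M) \<Longrightarrow> loss_step k L N \<Longrightarrow> loss_step k L' N"
  unfolding loss_step_def
  using all_upto_mono[of "win_step k L" "win_step k L'", OF win_step_mono[of L L']] by blast

lemma loses_upto_mono: "m \<le> n \<Longrightarrow> loses_upto k m N \<Longrightarrow> loses_upto k n N"
proof (induction m arbitrary: n N)
  case (Suc m)
  from Suc.prems(1) obtain n' where n: "n = Suc n'" "m \<le> n'" by (cases n) auto
  show ?case
    using Suc.prems(2) loss_step_mono[OF Suc.IH[OF n(2)]] by (simp add: n)
qed simp

lemma win_step_loses_ever: "win_step k (loses_ever k) N \<longleftrightarrow> (\<exists>n. win_step k (loses_upto k n) N)"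
  by (simp add: win_step_def loses_ever_def all_upto_all)

text \<open>
  The union of the stages is a fixed point of the step by continuity of the step along increasing
  sequences, that is, by finite branching.
\<close>

lemma loss_step_loses_ever: "loss_step k (loses_ever k) = loses_ever k"
proof
  fix N
  have "win_step k (loses_ever k) = (\<lambda>M. \<exists>n. win_step k (loses_upto k n) M)"
    by (rule ext) (rule win_step_loses_ever)
  then have "all_upto (win_step k (loses_ever k)) k N \<longleftrightarrow>
      all_upto (\<lambda>M. \<exists>n. win_step k (loses_upto k n) M) k N"
    by simp
  also have "\<dots> \<longleftrightarrow> (\<exists>n. all_upto (win_step k (loses_upto k n)) k N)"
    by (rule all_upto_ex, erule win_step_mono[rotated], rule loses_upto_mono)
  finally have "loss_step k (loses_ever k) N \<longleftrightarrow> (\<exists>n. loses_upto k (Suc n) N)"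
    by (simp add: loss_step_def)
  also have "\<dots> \<longleftrightarrow> loses_ever k N"
    unfolding loses_ever_def using loses_upto_mono[OF le_SucI[OF order_refl]] by blast
  finally show "loss_step k (loses_ever k) N = loses_ever k N" .
qed

text \<open>
  If \<open>N\<close> were lost at stage \<open>m\<close> and won at stage \<open>n\<close>, the move that wins would
  lead to a tree that is lost at stage \<open>n\<close> and won at stage \<open>m - 1\<close>; the sum of the
  indices drops.
\<close>

lemma not_loses_and_wins:
  "loses_upto k m N \<Longrightarrow> \<not> win_step k (loses_upto k n) N"
proof (induction "m + n" arbitrary: m n N rule: less_induct)
  case less
  then obtain m' where m: "m = Suc m'" by (cases m) auto
  show ?case
  proof
    assume "win_step k (loses_upto k n) N"
    then have "\<not> all_upto (\<lambda>M. \<not> loses_upto k n M) k N" and "all_upto (win_step k (loses_upto k m')) k N"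
      using less.prems m by (auto simp: win_step_def loss_step_def)
    then obtain M where "loses_upto k n M" "win_step k (loses_upto k m') M"
      using all_upto_mono[of "win_step k (loses_upto k m')" "\<lambda>M. \<not> loses_upto k n M"] by blast
    then show False using less.hyps[of n m' M] m by simp
  qed
qed

lemma loses_everD:
  assumes "loses_ever k N"
  shows "N [] \<noteq> 0" "all_upto (\<lambda>M. \<not> loses_ever k M) k N"
proof -
  have step: "loss_step k (loses_ever k) N"
    unfolding loss_step_loses_ever by (rule assms)
  then show "N [] \<noteq> 0" by (simp add: loss_step_def)
  have "\<not> loses_ever k M" if "win_step k (loses_ever k) M" for M
    using that not_loses_and_wins unfolding win_step_loses_ever unfolding loses_ever_def by blast
  moreover have "all_upto (win_step k (loses_ever k)) k N"
    using step by (simp add: loss_step_def)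
  ultimately show "all_upto (\<lambda>M. \<not> loses_ever k M) k N" by (rule all_upto_mono)
qed

lemma loses_upto_imp_ever: "loses_upto k n N \<Longrightarrow> loses_ever k N"
  by (auto simp: loses_ever_def)

lemma measurable_loses_upto [measurable]: "Measurable.pred (offspring_space chi) (loses_upto k n)"
  by (induction n) auto

lemma measurable_loses_ever [measurable]: "Measurable.pred (offspring_space chi) (loses_ever k)"
  unfolding loses_ever_def[abs_def] by measurable

lemma P1_loses_root_iff:
  assumes "1 \<le> k"
  shows "P1_loses (descendants_upto (GW_tree N) k) [] \<longleftrightarrow> loses_ever k N"
  using assms by (simp add: P1_loses_iff finite_descendants loses_within_iff_loses_upto loses_ever_def)

lemma P1_wins_root_iff:
  assumes "1 \<le> k"
  shows "P1_wins (descendants_upto (GW_tree N) k) [] \<longleftrightarrow> win_step k (loses_ever k) N"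
  using wins_within_iff_win_step[OF assms Nil_in_GW_tree loses_within_iff_loses_upto[OF assms]]
  by (simp add: P1_wins_iff finite_descendants win_step_loses_ever)

lemma tendsto_pr_loses_upto: "(\<lambda>n. pr chi (loses_upto k n)) \<longlonglongrightarrow> pr chi (loses_ever k)"
proof -
  interpret prob_space "offspring_space chi" by (rule prob_space_offspring_space)
  have "{N \<in> space (offspring_space chi). loses_upto k n N} \<in> events" for n
    by measurable
  then have "(\<lambda>n. pr chi (loses_upto k n)) \<longlonglongrightarrow> prob (\<Union>n. {N. loses_upto k n N})"
    by (intro finite_Lim_measure_incseq) (auto simp: incseq_def intro: loses_upto_mono)
  also have "(\<Union>n. {N. loses_upto k n N}) = {N. loses_ever k N}"
    by (auto simp: loses_ever_def)
  finally show ?thesis .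
qed

theorem theorem1p2:
  fixes chi :: "nat pmf" and k :: nat
  assumes "0 < pmf chi 0" and "pmf chi 0 < 1" and "1 \<le> k"
  shows "(ml chi k \<in> {0..c chi (k - 1)} \<and> 0 < ml chi k \<and> J chi k (ml chi k) = ml chi k \<and>
          (\<forall>x \<in> {0..c chi (k - 1)}. 0 < x \<and> J chi k x = x \<longrightarrow> ml chi k \<le> x)) \<and>
         mw chi k = 1 - F chi k (ml chi k) + pmf chi 0"
proof -
  interpret ever: loss_labelling chi k "loses_ever k"
    using assms by unfold_locales (auto dest: loses_everD)
  have upto: "loss_labelling chi k (loses_upto k n)" for n
    using assms
  proof unfold_locales
    fix N assume "loses_upto k n N"
    then have "loses_ever k N" by (rule loses_upto_imp_ever)
    note D = loses_everD[OF this]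
    show "N [] \<noteq> 0" by (rule D)
    show "all_upto (\<lambda>M. \<not> loses_upto k n M) k N"
      using D(2) by (rule all_upto_mono[rotated]) (blast dest: loses_upto_imp_ever)
  qed auto
  have ml: "ml chi k = pr chi (loses_ever k)"
    using assms(3) by (simp add: ml_def P1_loses_root_iff)
  have mw: "mw chi k = pr chi (win_step k (loses_ever k))"
    using assms(3) by (simp add: mw_def P1_wins_root_iff)
  have range: "ml chi k \<in> {0..c chi (k - 1)}"
    unfolding ml by (rule ever.pr_L_le_c)
  have fixed: "J chi k (ml chi k) = ml chi k"
    using ever.pr_loss_step unfolding ml loss_step_loses_ever by simp
  have pos: "0 < ml chi k"
    using J_0_pos[OF assms] fixed range by (cases "ml chi k = 0") auto
  have minimal: "ml chi k \<le> x" if x: "x \<in> {0..c chi (k - 1)}" "J chi k x = x" for x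
  proof -
    have "pr chi (loses_upto k n) \<le> x" for n
    proof (induction n)
      case (Suc n)
      have "pr chi (loses_upto k (Suc n)) = J chi k (pr chi (loses_upto k n))"
        using loss_labelling.pr_loss_step[OF upto] by simp
      also have "\<dots> \<le> J chi k x"
        using Suc x(1) loss_labelling.pr_L_le_c[OF upto, of n] by (intro J_mono assms) auto
      finally show ?case using x(2) by simp
    qed (use x in simp)
    then show ?thesis
      unfolding ml by (intro LIMSEQ_le_const2[OF tendsto_pr_loses_upto]) blast
  qed
  from range pos fixed minimal show ?thesis
    using ever.pr_W unfolding mw ml by simp
qed

end
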